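(* For every dimension $N$ there exist constants $C_1>1$ and $C_2,C_3>0$ depending only on $N$ such that the following holds. Let $\Omega\subset\mathbb R^N$ be a bounded open convex domain satisfying a uniform interior sphere condition of radius $\rho>0$, with diameter $d$, inradius $r$ and first Dirichlet eigenvalue $\lambda^D$. Let $u^D>0$ be a first Dirichlet Laplacian eigenfunction in $\Omega$, and let $$\sigma:=\min\Big\{\frac\rho2,\ C_0\,r\Big\},\qquad C_0:=\sqrt{\frac{\theta}{\lambda^D(B_1^N)}} .$$ Then $$\min_{\partial\Omega}|\nabla u^D|\ \ge\ \frac{C_2}{\rho}\,\Big(\max_{\overline\Omega}u^D\Big)\,C_1^{-d\left(\sqrt{\lambda^D}/2+2\sqrt N/\sigma\right)} .$$ In particular, if $u^D$ is normalized so that $\|u^D\|_{L^2(\Omega)}=1$, then $$\min_{\partial\Omega}|\nabla u^D|\ \ge\ \frac{C_3}{\rho}\,d^{-N/2}\,C_1^{-d\left(\sqrt{\lambda^D}/2+2\sqrt N/\sigma\right)} .$$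
   Context: $B_1^N$ is the unit ball of $\mathbb R^N$ and $\lambda^D(B_1^N)$ its first Dirichlet eigenvalue. $\theta$ is a fixed universal constant, $\theta\simeq0.0833$, with the following (known) property: for every bounded convex domain $\Omega\subset\mathbb R^N$, every maximum point $\overline x$ of a positive first Dirichlet eigenfunction of $\Omega$ satisfies $\operatorname{dist}(\overline x,\partial\Omega)\ge C_0\,r(\Omega)$, where $C_0=\sqrt{\theta/\lambda^D(B_1^N)}$ and $r(\Omega)$ is the inradius of $\Omega$; one has $0<C_0<1$ in every dimension. Uniform interior sphere condition of radius $\rho$: for every $x_0\in\partial\Omega$ there is a ball $B_\rho(z)\subset\Omega$ with $x_0\in\partial B_\rho(z)$. *)

theory Defs
  imports "HOL-Analysis.Analysis"
begin

definition partial :: "'a::euclidean_space \<Rightarrow> ('a \<Rightarrow> real) \<Rightarrow> 'a \<Rightarrow> real" where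
  "partial i u x = frechet_derivative u (at x) i"

definition C2_on :: "'a::euclidean_space set \<Rightarrow> ('a \<Rightarrow> real) \<Rightarrow> bool" where
  "C2_on S u \<longleftrightarrow>
     (\<forall>x\<in>S. u differentiable (at x)) \<and>
     (\<forall>i\<in>Basis. \<forall>x\<in>S. partial i u differentiable (at x)) \<and>
     (\<forall>i\<in>Basis. \<forall>j\<in>Basis. continuous_on S (partial j (partial i u)))"

definition laplacian :: "('a::euclidean_space \<Rightarrow> real) \<Rightarrow> 'a \<Rightarrow> real" where
  "laplacian u x = (\<Sum>i\<in>Basis. partial i (partial i u) x)"

text \<open>Eigenfunctions are classical: twice continuously differentiable in the domain and continuous
  up to the boundary. On bounded convex domains these are, up to the choice of the representative,
  exactly the weak eigenfunctions in the Sobolev space of functions with zero trace. Only the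
  values of \<open>u\<close> on \<open>closure \<Omega>\<close> matter.\<close>

definition dirichlet_eigenfunction ::
    "'a::euclidean_space set \<Rightarrow> real \<Rightarrow> ('a \<Rightarrow> real) \<Rightarrow> bool" where
  "dirichlet_eigenfunction \<Omega> \<mu> u \<longleftrightarrow>
     C2_on \<Omega> u \<and> continuous_on (closure \<Omega>) u \<and>
     (\<exists>x\<in>\<Omega>. u x \<noteq> 0) \<and>
     (\<forall>x\<in>\<Omega>. - laplacian u x = \<mu> * u x) \<and>
     (\<forall>x\<in>frontier \<Omega>. u x = 0)"

text \<open>The infimum is attained, hence is the smallest Dirichlet eigenvalue, whenever \<open>\<Omega>\<close> is a bounded
  convex domain.\<close>

definition first_dirichlet_eigenvalue :: "'a::euclidean_space set \<Rightarrow> real" where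
  "first_dirichlet_eigenvalue \<Omega> = Inf {\<mu>. \<exists>u. dirichlet_eigenfunction \<Omega> \<mu> u}"

definition first_dirichlet_eigenfunction ::
    "'a::euclidean_space set \<Rightarrow> ('a \<Rightarrow> real) \<Rightarrow> bool" where
  "first_dirichlet_eigenfunction \<Omega> u \<longleftrightarrow>
     dirichlet_eigenfunction \<Omega> (first_dirichlet_eigenvalue \<Omega>) u"

definition bounded_convex_domain :: "'a::euclidean_space set \<Rightarrow> bool" where
  "bounded_convex_domain \<Omega> \<longleftrightarrow> open \<Omega> \<and> bounded \<Omega> \<and> convex \<Omega> \<and> \<Omega> \<noteq> {}"

definition inradius :: "'a::euclidean_space set \<Rightarrow> real" where
  "inradius \<Omega> = Sup {s. 0 < s \<and> (\<exists>x. ball x s \<subseteq> \<Omega>)}"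

definition interior_sphere_condition :: "'a::euclidean_space set \<Rightarrow> real \<Rightarrow> bool" where
  "interior_sphere_condition \<Omega> \<rho> \<longleftrightarrow>
     (\<forall>x\<in>frontier \<Omega>. \<exists>z. ball z \<rho> \<subseteq> \<Omega> \<and> x \<in> sphere z \<rho>)"

definition C0 :: "'a::euclidean_space itself \<Rightarrow> real \<Rightarrow> real" where
  "C0 _ \<theta> = sqrt (\<theta> / first_dirichlet_eigenvalue (ball (0::'a) 1))"

text \<open>The known property of the universal constant \<open>\<theta>\<close>, about \<open>0.0833\<close>, in the dimension of the
  type \<open>'a\<close>. The constant enters only through this property, so its numerical value is not
  prescribed.\<close>

definition maximum_location_constant :: "'a::euclidean_space itself \<Rightarrow> real \<Rightarrow> bool" where
  "maximum_location_constant T \<theta> \<longleftrightarrow>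
     0 < C0 T \<theta> \<and> C0 T \<theta> < 1 \<and>
     (\<forall>(\<Omega> :: 'a set) u x.
        bounded_convex_domain \<Omega> \<longrightarrow>
        first_dirichlet_eigenfunction \<Omega> u \<longrightarrow> (\<forall>y\<in>\<Omega>. 0 < u y) \<longrightarrow>
        x \<in> \<Omega> \<longrightarrow> (\<forall>y\<in>\<Omega>. u y \<le> u x) \<longrightarrow>
        C0 T \<theta> * inradius \<Omega> \<le> infdist x (frontier \<Omega>))"

text \<open>\<open>G\<close> is the gradient of \<open>u\<close> at the boundary points of \<open>\<Omega>\<close>, taken from inside. It is uniquely
  determined there when \<open>\<Omega>\<close> is a bounded convex domain, because \<open>closure \<Omega>\<close> is then convex with
  nonempty interior.\<close>

definition boundary_gradient ::
    "'a::euclidean_space set \<Rightarrow> ('a \<Rightarrow> real) \<Rightarrow> ('a \<Rightarrow> 'a) \<Rightarrow> bool" where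
  "boundary_gradient \<Omega> u G \<longleftrightarrow>
     (\<forall>x\<in>frontier \<Omega>. (u has_derivative (\<lambda>h. G x \<bullet> h)) (at x within closure \<Omega>))"

end

theory Submission
  imports Defs
begin

text \<open>All comparisons rest on the minimum principle. The gradient at a boundary point is found by
  comparing \<open>u\<close> with multiples of a barrier for the interior tangent ball: take the largest slope for
  which the multiple stays below \<open>u\<close> near the point. If \<open>u\<close> exceeded the resulting linear function along
  some sequence, then \<open>u\<close> minus a slightly smaller multiple would be a nonnegative superharmonic
  function, by an interior Lipschitz estimate bounded below on balls that are not too small compared
  with the distance to the point, and a chain of balls followed by the Hopf lemma would improve the
  slope by a fixed amount. The quantitative bound comes from the same tools. By the Lipschitz estimate
  \<open>u\<close> is at least half of its maximum on a ball about the maximum point, of radius comparable to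
  the minimum of \<open>\<sigma>\<close> and the inverse square root of the eigenvalue. A chain of balls carries this
  bound to the centre of the interior tangent ball, at the cost of the exponential factor, and the
  Hopf lemma carries it to the boundary. No Harnack inequality is needed, since the chain starts
  from a ball and \<open>u\<close> is superharmonic.\<close>

section \<open>The minimum principle\<close>

text \<open>Existence of the boundary gradient is part of the claim: eigenfunctions are only
  continuous up to the boundary, and the boundary offers only tangent balls and supporting
  hyperplanes. The two fit together: by \<open>convex_inner_normal\<close> the hyperplane at
  \<open>x0\<close> is orthogonal to the radius \<open>z - x0\<close>. So the bound from above
  (slab) and the bound from below (barrier) are both linear, to leading order, in the same function
  \<open>s x = (x - x0) \<bullet> (z - x0)\<close>, but with different slopes. The slab bound
  \<open>u x \<le> C * s x\<close> also tames the points where the expansion fails: an excess of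
  \<open>\<eta> * norm (x - x0)\<close> forces \<open>s x\<close> to be of the order of
  \<open>norm (x - x0)\<close>, so such points approach \<open>x0\<close> inside a cone and carry
  balls of comparable radius inside the tangent ball. There every estimate scales with the distance
  to \<open>x0\<close>. Hence the gain in slope depends neither on that distance nor on the current
  slope, and a slope closer to the supremum than the gain gives a contradiction. In the quantitative
  part each doubling of a ball costs a factor \<open>exp (- 8 * N)\<close>, so the exponent counts
  balls: the diameter divided by their radius.\<close>

text \<open>Only derivatives along the coordinate axes are used, which makes reflections in coordinate
  hyperplanes and the second derivative test one-dimensional.\<close>

definition has_lap :: "('a::euclidean_space \<Rightarrow> real) \<Rightarrow> real \<Rightarrow> 'a \<Rightarrow> bool" where
  "has_lap u L x \<longleftrightarrow> (\<exists>D D2.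
     (\<forall>i\<in>Basis. (\<forall>\<^sub>F t in nhds 0. ((\<lambda>s. u (x + s *\<^sub>R i)) has_real_derivative D i t) (at t)) \<and>
        (D i has_real_derivative D2 i) (at 0)) \<and>
     L = (\<Sum>i\<in>Basis. D2 i))"

lemma has_lapI:
  assumes "\<And>i. i \<in> Basis \<Longrightarrow>
      \<forall>\<^sub>F t in nhds 0. ((\<lambda>s. u (x + s *\<^sub>R i)) has_real_derivative D i t) (at t)"
    and "\<And>i. i \<in> Basis \<Longrightarrow> (D i has_real_derivative D2 i) (at 0)"
    and "L = (\<Sum>i\<in>Basis. D2 i)"
  shows "has_lap u L x"
  unfolding has_lap_def using assms by blast

lemma has_lap_add:
  assumes "has_lap u L x" "has_lap v M x"
  shows "has_lap (\<lambda>y. u y + v y) (L + M) x"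
proof -
  obtain D D2 where D: "\<forall>i\<in>Basis. (\<forall>\<^sub>F t in nhds 0. ((\<lambda>s. u (x + s *\<^sub>R i)) has_real_derivative D i t) (at t)) \<and>
        (D i has_real_derivative D2 i) (at 0)" "L = (\<Sum>i\<in>Basis. D2 i)"
    using assms(1) unfolding has_lap_def by blast
  obtain E E2 where E: "\<forall>i\<in>Basis. (\<forall>\<^sub>F t in nhds 0. ((\<lambda>s. v (x + s *\<^sub>R i)) has_real_derivative E i t) (at t)) \<and>
        (E i has_real_derivative E2 i) (at 0)" "M = (\<Sum>i\<in>Basis. E2 i)"
    using assms(2) unfolding has_lap_def by blast
  show ?thesis
  proof (rule has_lapI)
    fix i :: 'a assume i: "i \<in> Basis"
    show "\<forall>\<^sub>F t in nhds 0. ((\<lambda>s. u (x + s *\<^sub>R i) + v (x + s *\<^sub>R i)) has_real_derivative D i t + E i t) (at t)"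
      using bspec[OF D(1) i, THEN conjunct1] bspec[OF E(1) i, THEN conjunct1]
      by eventually_elim (rule DERIV_add)
    show "((\<lambda>t. D i t + E i t) has_real_derivative D2 i + E2 i) (at 0)"
      using D(1) E(1) i by (intro DERIV_add) auto
  qed (simp add: D(2) E(2) sum.distrib)
qed

lemma has_lap_cmult:
  assumes "has_lap u L x"
  shows "has_lap (\<lambda>y. c * u y) (c * L) x"
proof -
  obtain D D2 where D: "\<forall>i\<in>Basis. (\<forall>\<^sub>F t in nhds 0. ((\<lambda>s. u (x + s *\<^sub>R i)) has_real_derivative D i t) (at t)) \<and>
        (D i has_real_derivative D2 i) (at 0)" "L = (\<Sum>i\<in>Basis. D2 i)"
    using assms(1) unfolding has_lap_def by blast
  show ?thesis
  proof (rule has_lapI)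
    fix i :: 'a assume i: "i \<in> Basis"
    show "\<forall>\<^sub>F t in nhds 0. ((\<lambda>s. c * u (x + s *\<^sub>R i)) has_real_derivative c * D i t) (at t)"
      using bspec[OF D(1) i, THEN conjunct1] by eventually_elim (rule DERIV_cmult)
    show "((\<lambda>t. c * D i t) has_real_derivative c * D2 i) (at 0)"
      using D(1) i by (intro DERIV_cmult) auto
  qed (simp add: D(2) sum_distrib_left)
qed

lemma has_lap_diff:
  assumes "has_lap u L x" "has_lap v M x"
  shows "has_lap (\<lambda>y. u y - v y) (L - M) x"
  using has_lap_add[OF assms(1) has_lap_cmult[OF assms(2), of "-1"]] by simp

lemma norm_add_scaleR_Basis_sq:
  fixes x c i :: "'a::euclidean_space"
  assumes "i \<in> Basis"
  shows "(norm (x + s *\<^sub>R i - c))\<^sup>2 = (norm (x - c))\<^sup>2 + 2 * s * ((x - c) \<bullet> i) + s\<^sup>2"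
proof -
  have "x + s *\<^sub>R i - c = (x - c) + s *\<^sub>R i" by simp
  then show ?thesis
    using assms by (simp only: power2_norm_eq_inner)
      (simp add: inner_simps inner_commute power2_eq_square algebra_simps)
qed

text \<open>One family covers all polynomial comparison functions: the perturbation in the minimum
  principle, the half-ball majorant and the slab majorant.\<close>

lemma has_lap_quadratic:
  fixes x c \<nu> :: "'a::euclidean_space"
  shows "has_lap (\<lambda>y. a * (norm (y - c))\<^sup>2 + b * ((y - c) \<bullet> \<nu>) + d * ((y - c) \<bullet> \<nu>)\<^sup>2 + e)
           (2 * real DIM('a) * a + 2 * d * (norm \<nu>)\<^sup>2) x"
proof (rule has_lapI)
  fix i :: 'a assume i: "i \<in> Basis"
  have eq: "a * (norm (x + s *\<^sub>R i - c))\<^sup>2 + b * ((x + s *\<^sub>R i - c) \<bullet> \<nu>) + d * ((x + s *\<^sub>R i - c) \<bullet> \<nu>)\<^sup>2 + e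
    = a * ((norm (x - c))\<^sup>2 + 2 * s * ((x - c) \<bullet> i) + s\<^sup>2)
       + b * ((x - c) \<bullet> \<nu> + s * (i \<bullet> \<nu>)) + d * ((x - c) \<bullet> \<nu> + s * (i \<bullet> \<nu>))\<^sup>2 + e" for s
    unfolding norm_add_scaleR_Basis_sq[OF i] by (simp add: inner_simps inner_commute algebra_simps)
  show "\<forall>\<^sub>F t in nhds 0. ((\<lambda>s. a * (norm (x + s *\<^sub>R i - c))\<^sup>2 + b * ((x + s *\<^sub>R i - c) \<bullet> \<nu>)
         + d * ((x + s *\<^sub>R i - c) \<bullet> \<nu>)\<^sup>2 + e) has_real_derivative
        a * (2 * ((x - c) \<bullet> i) + 2 * t) + b * (i \<bullet> \<nu>) + 2 * d * (((x - c) \<bullet> \<nu> + t * (i \<bullet> \<nu>)) * (i \<bullet> \<nu>))) (at t)"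
    unfolding eq by (intro always_eventually allI) (auto intro!: derivative_eq_intros simp: algebra_simps)
  show "((\<lambda>t. a * (2 * ((x - c) \<bullet> i) + 2 * t) + b * (i \<bullet> \<nu>) + 2 * d * (((x - c) \<bullet> \<nu> + t * (i \<bullet> \<nu>)) * (i \<bullet> \<nu>)))
          has_real_derivative (2 * a + 2 * d * (\<nu> \<bullet> i)\<^sup>2)) (at 0)"
    by (auto intro!: derivative_eq_intros simp: power2_eq_square inner_commute)
next
  have "(\<Sum>i\<in>Basis. (\<nu> \<bullet> i)\<^sup>2) = (norm \<nu>)\<^sup>2"
    by (simp add: norm_eq_sqrt_inner euclidean_inner[of \<nu> \<nu>] power2_eq_square sum_nonneg)
  then show "2 * real DIM('a) * a + 2 * d * (norm \<nu>)\<^sup>2 = (\<Sum>i\<in>Basis. 2 * a + 2 * d * (\<nu> \<bullet> i)\<^sup>2)"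
    by (simp add: sum.distrib sum_distrib_left[symmetric])
qed

lemma has_lap_exp:
  fixes x c :: "'a::euclidean_space"
  shows "has_lap (\<lambda>y. exp (\<alpha> * (b - (norm (y - c))\<^sup>2)))
           (exp (\<alpha> * (b - (norm (x - c))\<^sup>2)) * (4 * \<alpha>\<^sup>2 * (norm (x - c))\<^sup>2 - 2 * \<alpha> * real DIM('a))) x"
    (is "has_lap _ (?E * _) x")
proof (rule has_lapI)
  fix i :: 'a assume i: "i \<in> Basis"
  have eq: "exp (\<alpha> * (b - (norm (x + s *\<^sub>R i - c))\<^sup>2))
    = exp (\<alpha> * (b - ((norm (x - c))\<^sup>2 + 2 * s * ((x - c) \<bullet> i) + s\<^sup>2)))" for s
    unfolding norm_add_scaleR_Basis_sq[OF i] ..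
  show "\<forall>\<^sub>F t in nhds 0. ((\<lambda>s. exp (\<alpha> * (b - (norm (x + s *\<^sub>R i - c))\<^sup>2))) has_real_derivative
        exp (\<alpha> * (b - ((norm (x - c))\<^sup>2 + 2 * t * ((x - c) \<bullet> i) + t\<^sup>2))) * (- \<alpha> * (2 * ((x - c) \<bullet> i) + 2 * t))) (at t)"
    unfolding eq by (intro always_eventually allI) (auto intro!: derivative_eq_intros simp: algebra_simps)
  show "((\<lambda>t. exp (\<alpha> * (b - ((norm (x - c))\<^sup>2 + 2 * t * ((x - c) \<bullet> i) + t\<^sup>2))) * (- \<alpha> * (2 * ((x - c) \<bullet> i) + 2 * t)))
          has_real_derivative ?E * (4 * \<alpha>\<^sup>2 * ((x - c) \<bullet> i)\<^sup>2 - 2 * \<alpha>)) (at 0)"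
    by (auto intro!: derivative_eq_intros simp: power2_eq_square algebra_simps)
next
  have "(\<Sum>i\<in>Basis. ((x - c) \<bullet> i)\<^sup>2) = (norm (x - c))\<^sup>2"
    by (simp add: norm_eq_sqrt_inner euclidean_inner[of "x - c" "x - c"] power2_eq_square sum_nonneg)
  then show "?E * (4 * \<alpha>\<^sup>2 * (norm (x - c))\<^sup>2 - 2 * \<alpha> * real DIM('a))
      = (\<Sum>i\<in>Basis. ?E * (4 * \<alpha>\<^sup>2 * ((x - c) \<bullet> i)\<^sup>2 - 2 * \<alpha>))"
    by (simp add: sum_subtractf sum_distrib_left[symmetric])
qed

definition reflect :: "'a::euclidean_space \<Rightarrow> 'a \<Rightarrow> 'a \<Rightarrow> 'a" where
  "reflect c e x = x - (2 * ((x - c) \<bullet> e)) *\<^sub>R e"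

text \<open>For a coordinate vector \<open>e\<close> the reflection maps coordinate lines to
  coordinate lines and reverses only the direction \<open>e\<close>; the sign enters the second
  derivative squared.\<close>

lemma has_lap_reflect:
  assumes e: "e \<in> Basis" and u: "has_lap u L (reflect c e x)"
  shows "has_lap (\<lambda>y. u (reflect c e y)) L x"
proof -
  obtain D D2 where D: "\<forall>i\<in>Basis. (\<forall>\<^sub>F t in nhds 0. ((\<lambda>s. u (reflect c e x + s *\<^sub>R i)) has_real_derivative D i t) (at t)) \<and>
        (D i has_real_derivative D2 i) (at 0)" "L = (\<Sum>i\<in>Basis. D2 i)"
    using u unfolding has_lap_def by blast
  show ?thesis
  proof (rule has_lapI)
    fix i :: 'a assume i: "i \<in> Basis"
    define \<epsilon> :: real where "\<epsilon> = (if i = e then -1 else 1)"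
    have eq: "reflect c e (x + s *\<^sub>R i) = reflect c e x + (\<epsilon> * s) *\<^sub>R i" for s
      using e i by (auto simp: reflect_def \<epsilon>_def inner_simps inner_Basis algebra_simps
          simp flip: scaleR_add_left)
    have tend: "filterlim (\<lambda>t. \<epsilon> * t) (nhds 0) (nhds (0::real))"
      using tendsto_mult_left[OF filterlim_ident, of \<epsilon> "0::real"] by (simp add: id_def)
    have ev: "\<forall>\<^sub>F t in nhds 0. ((\<lambda>s. u (reflect c e x + s *\<^sub>R i)) has_real_derivative D i (\<epsilon> * t)) (at (\<epsilon> * t))"
      by (rule eventually_compose_filterlim[OF _ tend]) (use D i in auto)
    then show "\<forall>\<^sub>F t in nhds 0. ((\<lambda>s. u (reflect c e (x + s *\<^sub>R i))) has_real_derivative D i (\<epsilon> * t) * \<epsilon>) (at t)"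
      unfolding eq by eventually_elim (rule DERIV_chain'[where f="\<lambda>s. \<epsilon> * s", rotated], 
          auto intro!: derivative_eq_intros)
    have "((\<lambda>t. D i (\<epsilon> * t)) has_real_derivative D2 i * \<epsilon>) (at 0)"
      by (rule DERIV_chain'[where f="\<lambda>s. \<epsilon> * s", rotated]) (use D i in \<open>auto intro!: derivative_eq_intros\<close>)
    then have "((\<lambda>t. D i (\<epsilon> * t) * \<epsilon>) has_real_derivative D2 i * \<epsilon> * \<epsilon>) (at 0)"
      by (rule DERIV_cmult_right)
    then show "((\<lambda>t. D i (\<epsilon> * t) * \<epsilon>) has_real_derivative D2 i) (at 0)"
      by (auto simp: \<epsilon>_def split: if_splits)
  qed (simp add: D(2))
qed

lemma has_derivative_line:
  assumes "u differentiable (at (x + t *\<^sub>R i))"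
  shows "((\<lambda>s. u (x + s *\<^sub>R i)) has_real_derivative partial i u (x + t *\<^sub>R i)) (at t)"
proof -
  let ?F = "frechet_derivative u (at (x + t *\<^sub>R i))"
  have F: "(u has_derivative ?F) (at (x + t *\<^sub>R i))"
    using assms frechet_derivative_works by blast
  have "((\<lambda>s. u (x + s *\<^sub>R i)) has_derivative (\<lambda>h. ?F (h *\<^sub>R i))) (at t)"
    by (rule has_derivative_compose[where f="\<lambda>s. x + s *\<^sub>R i", OF _ F]) (auto intro!: derivative_eq_intros)
  moreover have "?F (h *\<^sub>R i) = ?F i * h" for h
    using linear_cmul[OF has_derivative_linear[OF F]] by simp
  ultimately show ?thesis
    by (simp add: has_field_derivative_def partial_def)
qed

lemma C2_on_has_lap:
  assumes "C2_on S u" "open S" "x \<in> S"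
  shows "has_lap u (laplacian u x) x"
proof (rule has_lapI)
  fix i :: 'a assume i: "i \<in> Basis"
  have "\<forall>\<^sub>F t in nhds 0. x + t *\<^sub>R i \<in> S"
  proof (rule eventually_compose_filterlim[where f="\<lambda>t. x + t *\<^sub>R i"])
    show "\<forall>\<^sub>F y in nhds x. y \<in> S" using assms by (simp add: eventually_nhds_in_open)
    have "((\<lambda>t. x + t *\<^sub>R i) \<longlongrightarrow> x + 0 *\<^sub>R i) (nhds 0)"
      by (intro tendsto_intros filterlim_ident)
    then show "((\<lambda>t. x + t *\<^sub>R i) \<longlongrightarrow> x) (nhds 0)" by simp
  qed
  then show "\<forall>\<^sub>F t in nhds 0. ((\<lambda>s. u (x + s *\<^sub>R i)) has_real_derivative partial i u (x + t *\<^sub>R i)) (at t)"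
    by eventually_elim (use assms in \<open>auto intro!: has_derivative_line simp: C2_on_def\<close>)
  show "((\<lambda>t. partial i u (x + t *\<^sub>R i)) has_real_derivative partial i (partial i u) x) (at 0)"
    using has_derivative_line[of "partial i u" x 0 i] assms i by (auto simp: C2_on_def)
qed (simp add: laplacian_def)

text \<open>If \<open>D2\<close> were negative, \<open>D\<close> would vanish at 0 and be negative
  just to the right, and the mean value theorem would push \<open>f\<close> below
  \<open>f 0\<close>. The second derivative is assumed at 0 only, which is what
  \<open>has_lap\<close> provides.\<close>

lemma second_derivative_nonneg_at_min:
  fixes f :: "real \<Rightarrow> real"
  assumes f: "\<forall>\<^sub>F t in nhds 0. (f has_real_derivative D t) (at t)"
    and D: "(D has_real_derivative D2) (at 0)"
    and min: "\<forall>\<^sub>F t in nhds 0. f 0 \<le> f t"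
  shows "0 \<le> D2"
proof (rule ccontr)
  assume "\<not> 0 \<le> D2"
  then have neg: "D2 < 0" by simp
  obtain d where d: "d > 0" "\<And>t. \<bar>t\<bar> < d \<Longrightarrow> (f has_real_derivative D t) (at t)" "\<And>t. \<bar>t\<bar> < d \<Longrightarrow> f 0 \<le> f t"
    using eventually_conj[OF f min] unfolding eventually_nhds_metric by (auto simp: dist_real_def)
  have D0: "D 0 = 0"
    by (rule DERIV_local_min[where f=f and x=0 and d=d]) (use d in auto)
  obtain e where e: "e > 0" "\<And>h. 0 < h \<Longrightarrow> h < e \<Longrightarrow> D h < 0"
    using DERIV_neg_dec_right[OF D neg] D0 by auto
  define t where "t = min d e / 2"
  have t: "0 < t" "t < d" "t < e" using d(1) e(1) by (auto simp: t_def)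
  have "\<exists>z>0. z < t \<and> f t - f 0 = (t - 0) * D z"
    by (rule MVT2[OF t(1)]) (use d t in auto)
  then obtain z where "0 < z" "z < t" "f t - f 0 = t * D z" by auto
  moreover have "t * D z < 0" using e(2)[of z] \<open>0 < z\<close> \<open>z < t\<close> t by (simp add: mult_pos_neg)
  ultimately show False using d(3)[of t] t by simp
qed

lemma lap_nonneg_at_min:
  assumes "has_lap v L x" and min: "\<forall>\<^sub>F y in nhds x. v x \<le> v y"
  shows "0 \<le> L"
proof -
  obtain D D2 where D: "\<forall>i\<in>Basis. (\<forall>\<^sub>F t in nhds 0. ((\<lambda>s. v (x + s *\<^sub>R i)) has_real_derivative D i t) (at t)) \<and>
        (D i has_real_derivative D2 i) (at 0)" "L = (\<Sum>i\<in>Basis. D2 i)"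
    using assms(1) unfolding has_lap_def by blast
  have "0 \<le> D2 i" if i: "i \<in> Basis" for i
  proof (rule second_derivative_nonneg_at_min)
    have "((\<lambda>t. x + t *\<^sub>R i) \<longlongrightarrow> x + 0 *\<^sub>R i) (nhds 0)"
      by (intro tendsto_intros filterlim_ident)
    then have "\<forall>\<^sub>F t in nhds 0. v x \<le> v (x + t *\<^sub>R i)"
      by (intro eventually_compose_filterlim[OF min]) simp
    then show "\<forall>\<^sub>F t in nhds 0. v (x + 0 *\<^sub>R i) \<le> v (x + t *\<^sub>R i)" by simp
  qed (use D i in auto)
  then show ?thesis by (simp add: D(2) sum_nonneg)
qed

text \<open>At an interior minimum the Laplacian is nonnegative, which contradicts only a strictly
  negative one; subtracting a small paraboloid supplies the strictness. Boundary values and the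
  differential inequality form a single obligation, restricted to points where \<open>v\<close> is
  negative, so in an application a region is excluded by showing that \<open>v\<close> is
  nonnegative there.\<close>

lemma minimum_principle:
  fixes v :: "'a::euclidean_space \<Rightarrow> real"
  assumes S: "compact S" and v: "continuous_on S v"
    and neg: "\<And>x. x \<in> S \<Longrightarrow> v x < 0 \<Longrightarrow> x \<in> interior S \<and> (\<exists>L\<le>0. has_lap v L x)"
    and x: "x \<in> S"
  shows "0 \<le> v x"
proof (rule ccontr)
  assume "\<not> 0 \<le> v x"
  then have vx: "v x < 0" by simp
  obtain B where B: "B > 0" "\<And>y. y \<in> S \<Longrightarrow> norm y \<le> B"
    using compact_imp_bounded[OF S] bounded_pos by blast
  \<comment> \<open>Small enough that the perturbed function is still at most
    \<open>v x / 2\<close>, hence negative, at \<open>x\<close>.\<close>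
  define \<epsilon> where "\<epsilon> = - v x / (2 * B\<^sup>2)"
  have \<epsilon>: "\<epsilon> > 0" using vx B by (simp add: \<epsilon>_def field_simps)
  define w where "w y = v y + ((-\<epsilon>) * (norm (y - 0))\<^sup>2 + 0 * ((y - 0) \<bullet> 0) + 0 * ((y - 0) \<bullet> 0)\<^sup>2 + \<epsilon> * B\<^sup>2)" for y
  have w: "w y = v y + \<epsilon> * (B\<^sup>2 - (norm y)\<^sup>2)" for y by (simp add: w_def algebra_simps)
  have "continuous_on S w" unfolding w_def by (intro continuous_intros v)
  then obtain y where y: "y \<in> S" "\<And>z. z \<in> S \<Longrightarrow> w y \<le> w z"
    using continuous_attains_inf[OF S, of w] x by blast
  have "w x \<le> v x + \<epsilon> * B\<^sup>2" using \<epsilon> by (simp add: w)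
  also have "\<dots> = v x / 2" using B by (simp add: \<epsilon>_def)
  finally have "w y < 0" using y(2)[OF x] vx by simp
  moreover have "0 \<le> \<epsilon> * (B\<^sup>2 - (norm y)\<^sup>2)" using \<epsilon> B(2)[OF y(1)] by (simp add: power_mono)
  ultimately have "v y < 0" by (simp add: w)
  then obtain L where L: "y \<in> interior S" "L \<le> 0" "has_lap v L y" using neg y by blast
  have "has_lap w (L + (2 * real DIM('a) * (-\<epsilon>) + 2 * 0 * (norm (0::'a))\<^sup>2)) y"
    unfolding w_def[abs_def] by (intro has_lap_add L(3) has_lap_quadratic)
  moreover have "\<forall>\<^sub>F z in nhds y. w y \<le> w z"
    using eventually_nhds_in_open[OF open_interior L(1)]
    by eventually_elim (use y(2) interior_subset in blast)
  ultimately have "0 \<le> L + (2 * real DIM('a) * (-\<epsilon>) + 2 * 0 * (norm (0::'a))\<^sup>2)"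
    by (rule lap_nonneg_at_min)
  then have "0 \<le> L - 2 * real DIM('a) * \<epsilon>" by simp
  moreover have "2 * real DIM('a) * \<epsilon> > 0" using \<epsilon> DIM_positive[where 'a='a] by simp
  ultimately show False using L(2) by linarith
qed

section \<open>Superharmonic functions and interior estimates\<close>

definition superharmonic_on :: "'a::euclidean_space set \<Rightarrow> ('a \<Rightarrow> real) \<Rightarrow> bool" where
  "superharmonic_on S v \<longleftrightarrow> (\<forall>x\<in>S. \<exists>L\<le>0. has_lap v L x)"

text \<open>The factor 8 makes the barrier subharmonic outside \<open>ball c (R / 4)\<close>.\<close>

definition barrier :: "'a::euclidean_space \<Rightarrow> real \<Rightarrow> 'a \<Rightarrow> real" where
  "barrier c R x = exp (8 * real DIM('a) / R\<^sup>2 * (R\<^sup>2 - (norm (x - c))\<^sup>2)) - 1"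

lemma continuous_on_barrier: "continuous_on S (barrier c R)"
  unfolding barrier_def by (intro continuous_intros)

lemma barrier_sphere: "norm (x - c) = R \<Longrightarrow> barrier c R x = 0"
  by (simp add: barrier_def)

lemma barrier_ge:
  "8 * real DIM('a) / R\<^sup>2 * (R\<^sup>2 - (norm (x - c))\<^sup>2) \<le> barrier c R (x :: 'a::euclidean_space)"
  using exp_ge_add_one_self[of "8 * real DIM('a) / R\<^sup>2 * (R\<^sup>2 - (norm (x - c))\<^sup>2)"]
  unfolding barrier_def by linarith

lemma barrier_nonneg:
  fixes x c :: "'a::euclidean_space"
  assumes "norm (x - c) \<le> R"
  shows "0 \<le> barrier c R x"
proof -
  have "(norm (x - c))\<^sup>2 \<le> R\<^sup>2" using assms by (intro power_mono) auto
  then have "0 \<le> 8 * real DIM('a) / R\<^sup>2 * (R\<^sup>2 - (norm (x - c))\<^sup>2)" by simp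
  then show ?thesis using barrier_ge[of R x c] by linarith
qed

lemma barrier_le:
  fixes x c :: "'a::euclidean_space"
  assumes "0 < R"
  shows "barrier c R x \<le> exp (8 * real DIM('a))"
proof -
  have "8 * real DIM('a) / R\<^sup>2 * (R\<^sup>2 - (norm (x - c))\<^sup>2) \<le> 8 * real DIM('a)"
    using assms by (simp add: field_simps)
  then have "exp (8 * real DIM('a) / R\<^sup>2 * (R\<^sup>2 - (norm (x - c))\<^sup>2)) \<le> exp (8 * real DIM('a))"
    by simp
  then show ?thesis unfolding barrier_def by linarith
qed

text \<open>The Laplacian of the exponential has the sign of
  \<open>2 * \<alpha> * (norm (x - c))\<^sup>2 - real DIM('a)\<close>; for this \<alpha> it changes
  sign exactly at distance \<open>R / 4\<close>.\<close>

lemma has_lap_barrier: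
  fixes x c :: "'a::euclidean_space"
  assumes R: "0 < R" and x: "R / 4 \<le> norm (x - c)"
  shows "\<exists>L\<ge>0. has_lap (barrier c R) L x"
proof -
  define \<alpha> where "\<alpha> = 8 * real DIM('a) / R\<^sup>2"
  have \<alpha>: "\<alpha> > 0" using R DIM_positive[where 'a='a] by (simp add: \<alpha>_def)
  let ?L = "exp (\<alpha> * (R\<^sup>2 - (norm (x - c))\<^sup>2)) * (4 * \<alpha>\<^sup>2 * (norm (x - c))\<^sup>2 - 2 * \<alpha> * real DIM('a))"
  have "has_lap (\<lambda>y. exp (\<alpha> * (R\<^sup>2 - (norm (y - c))\<^sup>2))
      + (0 * (norm (y - c))\<^sup>2 + 0 * ((y - c) \<bullet> 0) + 0 * ((y - c) \<bullet> 0)\<^sup>2 + (-1)))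
      (?L + (2 * real DIM('a) * 0 + 2 * 0 * (norm (0::'a))\<^sup>2)) x"
    by (intro has_lap_add has_lap_exp has_lap_quadratic)
  then have "has_lap (barrier c R) ?L x" unfolding barrier_def[abs_def] \<alpha>_def by simp
  moreover have "0 \<le> ?L"
  proof -
    have "(R / 4)\<^sup>2 \<le> (norm (x - c))\<^sup>2" using x R by (intro power_mono) auto
    then have "4 * \<alpha>\<^sup>2 * (R / 4)\<^sup>2 \<le> 4 * \<alpha>\<^sup>2 * (norm (x - c))\<^sup>2" by (intro mult_left_mono) auto
    moreover have "4 * \<alpha>\<^sup>2 * (R / 4)\<^sup>2 = 2 * \<alpha> * real DIM('a)"
      using R by (simp add: \<alpha>_def power2_eq_square field_simps)
    ultimately show ?thesis by simp
  qed
  ultimately show ?thesis by blast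
qed

text \<open>The comparison step of the Hopf lemma. In the core \<open>cball c (R / 4)\<close> the
  scaled barrier is at most \<open>m\<close>, on the sphere it vanishes, and in the annulus between
  them it is subharmonic, so \<open>v\<close> minus the scaled barrier can be negative only where it
  is superharmonic.\<close>

lemma superharmonic_barrier_bound:
  fixes v :: "'a::euclidean_space \<Rightarrow> real"
  assumes R: "0 < R" and v: "continuous_on (cball c R) v" "superharmonic_on (ball c R) v"
    and nonneg: "\<And>x. norm (x - c) = R \<Longrightarrow> 0 \<le> v x"
    and m: "0 \<le> m" "\<And>x. x \<in> cball c (R / 4) \<Longrightarrow> m \<le> v x"
    and x: "x \<in> cball c R"
  shows "m * exp (- 8 * real DIM('a)) * barrier c R x \<le> v x"
proof -
  let ?k = "m * exp (- 8 * real DIM('a))"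
  have k: "0 \<le> ?k" using m by simp
  have kb: "?k * barrier c R y \<le> m" for y
  proof -
    have "?k * barrier c R y \<le> ?k * exp (8 * real DIM('a))"
      by (intro mult_left_mono barrier_le R k)
    also have "\<dots> = m" by (simp add: exp_minus)
    finally show ?thesis .
  qed
  have "0 \<le> v x - ?k * barrier c R x"
  proof (rule minimum_principle[where S="cball c R"])
    show "continuous_on (cball c R) (\<lambda>x. v x - ?k * barrier c R x)"
      by (intro continuous_intros v continuous_on_barrier)
    fix y assume y: "y \<in> cball c R" and neg: "v y - ?k * barrier c R y < 0"
    have "norm (y - c) \<noteq> R" using neg nonneg[of y] barrier_sphere[of y c R] by auto
    then have yb: "y \<in> ball c R" using y by (auto simp: dist_norm norm_minus_commute)
    have "y \<notin> cball c (R / 4)" using m(2)[of y] kb[of y] neg by auto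
    then have "R / 4 \<le> norm (y - c)" by (auto simp: dist_norm norm_minus_commute)
    then obtain L where L: "0 \<le> L" "has_lap (barrier c R) L y" using has_lap_barrier[OF R] by blast
    obtain L' where L': "L' \<le> 0" "has_lap v L' y" using v(2) yb unfolding superharmonic_on_def by blast
    have "has_lap (\<lambda>x. v x - ?k * barrier c R x) (L' - ?k * L) y"
      by (intro has_lap_diff has_lap_cmult L L')
    moreover have "L' - ?k * L \<le> 0" using L' L k mult_nonneg_nonneg[of ?k L] by linarith
    ultimately show "y \<in> interior (cball c R) \<and> (\<exists>L\<le>0. has_lap (\<lambda>x. v x - ?k * barrier c R x) L y)"
      using yb unfolding interior_cball by blast
  qed (use x in auto)
  then show ?thesis by simp
qed

text \<open>Barrier comparison in the ball of radius \<open>4 * h\<close>, whose core is exactly the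
  ball of radius \<open>h\<close>.\<close>

lemma superharmonic_double_ball:
  fixes v :: "'a::euclidean_space \<Rightarrow> real"
  assumes h: "0 < h" and v: "continuous_on (cball q (4 * h)) v" "superharmonic_on (ball q (4 * h)) v"
    and nonneg: "\<And>x. x \<in> cball q (4 * h) \<Longrightarrow> 0 \<le> v x"
    and m: "0 \<le> m" "\<And>x. x \<in> cball q h \<Longrightarrow> m \<le> v x"
    and x: "x \<in> cball q (2 * h)"
  shows "m * exp (- 8 * real DIM('a)) \<le> v x"
proof -
  have n: "real DIM('a) \<ge> 1" using DIM_positive[where 'a='a] by linarith
  have x': "norm (x - q) \<le> 2 * h" using x by (simp add: dist_norm norm_minus_commute)
  have "m * exp (- 8 * real DIM('a)) * barrier q (4 * h) x \<le> v x"
    by (rule superharmonic_barrier_bound) (use assms in \<open>auto simp: dist_norm norm_minus_commute\<close>)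
  \<comment> \<open>Within distance \<open>2 * h\<close> the exponent is at least
    \<open>8 * 12 / 16 = 6\<close> times the dimension, far above what is needed.\<close>
  moreover have "1 \<le> barrier q (4 * h) x"
  proof -
    have "(norm (x - q))\<^sup>2 \<le> (2 * h)\<^sup>2" using x' by (intro power_mono) auto
    then have "12 * h\<^sup>2 \<le> (4 * h)\<^sup>2 - (norm (x - q))\<^sup>2" by (simp add: power2_eq_square)
    then have "8 * 1 / (4 * h)\<^sup>2 * (12 * h\<^sup>2) \<le> 8 * real DIM('a) / (4 * h)\<^sup>2 * ((4 * h)\<^sup>2 - (norm (x - q))\<^sup>2)"
      using n by (intro mult_mono divide_right_mono) auto
    moreover have "8 * 1 / (4 * h)\<^sup>2 * (12 * h\<^sup>2) \<ge> 1" using h by (simp add: power2_eq_square)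
    ultimately show ?thesis using barrier_ge[of "4 * h" x q] by linarith
  qed
  then have "m * exp (- 8 * real DIM('a)) * 1 \<le> m * exp (- 8 * real DIM('a)) * barrier q (4 * h) x"
    using m(1) by (intro mult_left_mono) auto
  ultimately show ?thesis by simp
qed

lemma cball_convex_combination:
  fixes q c :: "'a::euclidean_space"
  assumes D: "convex D" "cball q r \<subseteq> D" "cball c r \<subseteq> D" and t: "0 \<le> t" "t \<le> 1"
  shows "cball (q + t *\<^sub>R (c - q)) r \<subseteq> D"
proof
  fix y assume y: "y \<in> cball (q + t *\<^sub>R (c - q)) r"
  define w where "w = y - (q + t *\<^sub>R (c - q))"
  have w: "norm w \<le> r" using y by (simp add: w_def dist_norm norm_minus_commute)
  have "y = (1 - t) *\<^sub>R (q + w) + t *\<^sub>R (c + w)" by (simp add: w_def algebra_simps)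
  moreover have "q + w \<in> D" "c + w \<in> D" using D(2,3) w by (auto simp: subset_iff dist_norm)
  ultimately show "y \<in> D" using convexD[OF D(1), of "q + w" "c + w" "1 - t" t] t by simp
qed

text \<open>The centres divide the segment from \<open>q\<close> to \<open>c\<close> into
  \<open>k\<close> steps of length at most \<open>h\<close>, so each ball of radius \<open>h\<close>
  lies in the doubled previous one and the lower bound loses \<open>exp (- 8 * real DIM('a))\<close>
  per step. Convexity keeps the balls of radius \<open>4 * h\<close> inside
  \<open>D\<close>.\<close>

lemma superharmonic_chain:
  fixes v :: "'a::euclidean_space \<Rightarrow> real"
  assumes D: "convex D" and v: "continuous_on D v" "superharmonic_on D v" "\<And>x. x \<in> D \<Longrightarrow> 0 \<le> v x"
    and h: "0 < h" and q: "cball q (4 * h) \<subseteq> D" and c: "cball c (4 * h) \<subseteq> D"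
    and m: "0 \<le> m" "\<And>x. x \<in> cball q h \<Longrightarrow> m \<le> v x"
    and k: "norm (c - q) \<le> real k * h"
  shows "m * exp (- 8 * real DIM('a) * real k) \<le> v c"
proof (cases "k = 0")
  \<comment> \<open>Treated apart because the centres \<open>p j\<close> divide by \<open>k\<close>;
    here \<open>c = q\<close>.\<close>
  case True
  then have "c = q" using k by simp
  then show ?thesis using True m(2)[of c] h by simp
next
  case False
  define p where "p j = q + (real j / real k) *\<^sub>R (c - q)" for j
  have sub: "cball (p j) (4 * h) \<subseteq> D" if "j \<le> k" for j
    unfolding p_def by (rule cball_convex_combination[OF D q c]) (use that False in auto)
  have step: "cball (p (Suc j)) h \<subseteq> cball (p j) (2 * h)" for j
  proof
    fix x assume x: "x \<in> cball (p (Suc j)) h"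
    have "p (Suc j) - p j = (1 / real k) *\<^sub>R (c - q)"
      by (simp add: p_def algebra_simps add_divide_distrib)
    then have "norm (p (Suc j) - p j) = norm (c - q) / real k" by simp
    also have "\<dots> \<le> h" using k False by (simp add: field_simps)
    finally show "x \<in> cball (p j) (2 * h)"
      using x dist_triangle[of "p j" x "p (Suc j)"] by (simp add: dist_norm norm_minus_commute)
  qed
  have "\<forall>x\<in>cball (p j) h. m * exp (- 8 * real DIM('a) * real j) \<le> v x" if "j \<le> k" for j
    using that
  proof (induction j)
    case 0
    then show ?case using m by (simp add: p_def)
  next
    case (Suc j)
    show ?case
    proof
      fix x assume x: "x \<in> cball (p (Suc j)) h"
      have "m * exp (- 8 * real DIM('a) * real j) * exp (- 8 * real DIM('a)) \<le> v x"
      proof (rule superharmonic_double_ball[where q="p j" and h=h])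
        show "continuous_on (cball (p j) (4 * h)) v"
          by (rule continuous_on_subset[OF v(1) sub]) (use Suc in auto)
        show "superharmonic_on (ball (p j) (4 * h)) v"
          using v(2) sub[of j] Suc.prems ball_subset_cball[of "p j" "4 * h"] unfolding superharmonic_on_def by fastforce
        show "x \<in> cball (p j) (2 * h)" using step x by blast
      qed (use Suc v(3) sub[of j] h m in auto)
      then show "m * exp (- 8 * real DIM('a) * real (Suc j)) \<le> v x"
        by (simp add: algebra_simps flip: exp_add)
    qed
  qed
  from this[of k] have "m * exp (- 8 * real DIM('a) * real k) \<le> v (p k)" using h by auto
  then show ?thesis using False by (simp add: p_def)
qed

section \<open>Interior gradient estimate by reflection\<close>

lemma norm_reflect:
  assumes "e \<in> Basis"
  shows "norm (reflect c e x - c) = norm (x - c)"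
proof -
  have "reflect c e x - c = (x - c) - (2 * ((x - c) \<bullet> e)) *\<^sub>R e" by (simp add: reflect_def)
  then have "(norm (reflect c e x - c))\<^sup>2 = (norm (x - c))\<^sup>2"
    using assms by (simp only: power2_norm_eq_inner)
      (simp add: inner_simps inner_commute power2_eq_square algebra_simps)
  then show ?thesis by simp
qed

text \<open>The difference of \<open>u\<close> and its reflection vanishes on the hyperplane of symmetry, so it
  can be compared on a half ball with a quadratic polynomial.\<close>

lemma reflection_estimate:
  fixes u :: "'a::euclidean_space \<Rightarrow> real"
  assumes R: "0 < R" and u: "continuous_on (cball c R) u"
    and lap: "\<And>x. x \<in> ball c R \<Longrightarrow> \<exists>L. \<bar>L\<bar> \<le> K \<and> has_lap u L x"
    and M: "\<And>x. x \<in> cball c R \<Longrightarrow> \<bar>u x\<bar> \<le> M"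
    and e: "e \<in> Basis" and t: "0 \<le> t" "t \<le> R"
  shows "u (c + t *\<^sub>R e) - u (c - t *\<^sub>R e) \<le> t * (2 * real DIM('a) * M / R + K * R)"
proof -
  let ?n = "real DIM('a)"
  have n: "?n \<ge> 1" using DIM_positive[where 'a='a] by linarith
  have M0: "0 \<le> M" using M[of c] R by auto
  have K0: "0 \<le> K" using lap[of c] R by auto
  define S where "S = cball c R \<inter> {x. 0 \<le> (x - c) \<bullet> e}"
  \<comment> \<open>The squared norm makes \<psi> at least \<open>2 * M\<close> on the sphere, which
    bounds the difference there. The coefficient of the squared normal coordinate makes the
    Laplacian exactly \<open>- 2 * K\<close>, which absorbs both Laplacians. The linear coefficient
    keeps \<psi> nonnegative on the half ball, as the factored form \<open>\<psi>_eq\<close>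
    shows.\<close>
  define \<psi> where "\<psi> x = (2 * M / R\<^sup>2) * (norm (x - c))\<^sup>2 + (2 * M * ?n / R + K * R) * ((x - c) \<bullet> e)
     + (- (2 * M * ?n / R\<^sup>2) - K) * ((x - c) \<bullet> e)\<^sup>2 + 0" for x
  have cl: "closed {x. 0 \<le> (x - c) \<bullet> e}"
    by (intro closed_Collect_le continuous_intros)
  have op: "open {x. 0 < (x - c) \<bullet> e}"
    by (intro open_Collect_less continuous_intros)
  have refl: "reflect c e x \<in> cball c R" if "x \<in> cball c R" for x
    using that norm_reflect[OF e, of c x] by (simp add: dist_norm norm_minus_commute)
  have refl': "reflect c e x \<in> ball c R" if "x \<in> ball c R" for x
    using that norm_reflect[OF e, of c x] by (simp add: dist_norm norm_minus_commute)
  have \<psi>_eq: "\<psi> x = (2 * M / R\<^sup>2) * (norm (x - c))\<^sup>2 + ((x - c) \<bullet> e) * (R - (x - c) \<bullet> e) * (2 * M * ?n / R\<^sup>2 + K)" for x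
    using R by (simp add: \<psi>_def power2_eq_square field_simps)
  have "0 \<le> \<psi> x - (u x - u (reflect c e x))" if "x \<in> S" for x
  proof (rule minimum_principle[where S=S, OF _ _ _ that])
    show "compact S" unfolding S_def by (intro compact_Int_closed compact_cball cl)
    have "continuous_on S (\<lambda>x. u (reflect c e x))"
      by (rule continuous_on_compose2[OF u]) (use refl in \<open>auto simp: reflect_def[abs_def] S_def intro!: continuous_intros\<close>)
    moreover have "continuous_on S u" by (rule continuous_on_subset[OF u]) (auto simp: S_def)
    ultimately show "continuous_on S (\<lambda>x. \<psi> x - (u x - u (reflect c e x)))"
      unfolding \<psi>_def by (intro continuous_intros)
    fix y assume y: "y \<in> S" and neg: "\<psi> y - (u y - u (reflect c e y)) < 0"
    let ?s = "(y - c) \<bullet> e"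
    have s: "0 \<le> ?s" "?s \<le> norm (y - c)" "norm (y - c) \<le> R"
      using y Basis_le_norm[OF e, of "y - c"] by (auto simp: S_def dist_norm norm_minus_commute)
    have prod: "0 \<le> ?s * (R - ?s) * (2 * M * ?n / R\<^sup>2 + K)"
      using s M0 K0 n R by (intro mult_nonneg_nonneg add_nonneg_nonneg divide_nonneg_nonneg) auto
    have "?s \<noteq> 0"
    proof
      assume s0: "?s = 0"
      then have "reflect c e y = y" by (simp add: reflect_def)
      moreover have "0 \<le> \<psi> y" using s0 M0 by (simp add: \<psi>_eq)
      ultimately show False using neg by simp
    qed
    then have spos: "0 < ?s" using s by simp
    have "norm (y - c) \<noteq> R"
    proof
      assume "norm (y - c) = R"
      then have "2 * M \<le> \<psi> y" using prod R by (simp add: \<psi>_eq)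
      moreover have "\<bar>u y\<bar> \<le> M" "\<bar>u (reflect c e y)\<bar> \<le> M"
        using M y refl[of y] by (auto simp: S_def)
      ultimately show False using neg by linarith
    qed
    then have yb: "y \<in> ball c R" using s by (simp add: dist_norm norm_minus_commute)
    have "y \<in> interior S"
    proof (rule interiorI[where T="ball c R \<inter> {x. 0 < (x - c) \<bullet> e}"])
      show "open (ball c R \<inter> {x. 0 < (x - c) \<bullet> e})" using op by blast
    qed (use yb spos in \<open>auto simp: S_def\<close>)
    moreover
    obtain L where L: "\<bar>L\<bar> \<le> K" "has_lap u L y" using lap[OF yb] by blast
    obtain L' where L': "\<bar>L'\<bar> \<le> K" "has_lap u L' (reflect c e y)" using lap[OF refl'[OF yb]] by blast
    have "has_lap (\<lambda>x. \<psi> x - (u x - u (reflect c e x)))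
       ((2 * ?n * (2 * M / R\<^sup>2) + 2 * (- (2 * M * ?n / R\<^sup>2) - K) * (norm e)\<^sup>2) - (L - L')) y"
      unfolding \<psi>_def by (intro has_lap_diff has_lap_quadratic L has_lap_reflect[OF e L'(2)])
    moreover have "(2 * ?n * (2 * M / R\<^sup>2) + 2 * (- (2 * M * ?n / R\<^sup>2) - K) * (norm e)\<^sup>2) - (L - L') \<le> 0"
      using L L' e by (simp add: algebra_simps)
    ultimately show "y \<in> interior S \<and> (\<exists>L\<le>0. has_lap (\<lambda>x. \<psi> x - (u x - u (reflect c e x))) L y)"
      by blast
  qed
  moreover have "c + t *\<^sub>R e \<in> S" using t e by (simp add: S_def dist_norm)
  ultimately have "u (c + t *\<^sub>R e) - u (reflect c e (c + t *\<^sub>R e)) \<le> \<psi> (c + t *\<^sub>R e)" by fastforce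
  also have "reflect c e (c + t *\<^sub>R e) = c - t *\<^sub>R e"
    using e by (simp add: reflect_def algebra_simps flip: scaleR_add_left)
  also have "\<psi> (c + t *\<^sub>R e) = (2 * M / R\<^sup>2) * t\<^sup>2 * (1 - ?n) + t * (2 * M * ?n / R + K * R) - K * t\<^sup>2"
    using e t by (simp add: \<psi>_def algebra_simps diff_divide_distrib)
  also have "\<dots> \<le> t * (2 * ?n * M / R + K * R)"
  proof -
    have "(2 * M / R\<^sup>2) * t\<^sup>2 * (1 - ?n) \<le> 0" using M0 n by (intro mult_nonneg_nonpos) auto
    moreover have "0 \<le> K * t\<^sup>2" using K0 by simp
    ultimately show ?thesis by (simp add: mult.commute mult.left_commute)
  qed
  finally show ?thesis .
qed

text \<open>The symmetric difference quotient at \<open>c\<close> tends to \<open>2 * F e\<close>,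
  and \<open>reflection_estimate\<close>, applied to \<open>u\<close> and to \<open>- u\<close>,
  bounds it from both sides.\<close>

lemma partial_bound:
  fixes u :: "'a::euclidean_space \<Rightarrow> real"
  assumes R: "0 < R" and u: "continuous_on (cball c R) u"
    and lap: "\<And>x. x \<in> ball c R \<Longrightarrow> \<exists>L. \<bar>L\<bar> \<le> K \<and> has_lap u L x"
    and M: "\<And>x. x \<in> cball c R \<Longrightarrow> \<bar>u x\<bar> \<le> M"
    and diff: "(u has_derivative F) (at c)"
    and e: "e \<in> Basis"
  shows "\<bar>F e\<bar> \<le> real DIM('a) * M / R + K * R / 2"
proof -
  let ?B = "2 * real DIM('a) * M / R + K * R"
  define g where "g t = u (c + t *\<^sub>R e) - u (c - t *\<^sub>R e)" for t
  have "((\<lambda>t. u (c + t *\<^sub>R e)) has_derivative (\<lambda>h. F (h *\<^sub>R e))) (at 0)"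
    by (rule has_derivative_compose[where f="\<lambda>t. c + t *\<^sub>R e"]) (use diff in \<open>auto intro!: derivative_eq_intros\<close>)
  moreover have "((\<lambda>t. u (c - t *\<^sub>R e)) has_derivative (\<lambda>h. F (- (h *\<^sub>R e)))) (at 0)"
    by (rule has_derivative_compose[where f="\<lambda>t. c - t *\<^sub>R e"]) (use diff in \<open>auto intro!: derivative_eq_intros\<close>)
  ultimately have "(g has_derivative (\<lambda>h. F (h *\<^sub>R e) - F (- (h *\<^sub>R e)))) (at 0)"
    unfolding g_def[abs_def] by (rule has_derivative_diff)
  moreover have "F (h *\<^sub>R e) - F (- (h *\<^sub>R e)) = 2 * F e * h" for h
    using linear_cmul[OF has_derivative_linear[OF diff], of h e] linear_neg[OF has_derivative_linear[OF diff], of "h *\<^sub>R e"]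
    by simp
  ultimately have "(g has_real_derivative 2 * F e) (at 0)" by (simp add: has_field_derivative_def)
  then have "((\<lambda>h. (g h - g 0) / (h - 0)) \<longlongrightarrow> 2 * F e) (at 0)" by (simp add: has_field_derivative_iff)
  then have "((\<lambda>h. \<bar>g h / h\<bar>) \<longlongrightarrow> \<bar>2 * F e\<bar>) (at 0)"
    by (intro tendsto_rabs) (simp add: g_def)
  then have lim: "((\<lambda>h. \<bar>g h / h\<bar>) \<longlongrightarrow> \<bar>2 * F e\<bar>) (at_right 0)"
    by (rule tendsto_mono[OF at_le, rotated]) simp
  have "\<bar>2 * F e\<bar> \<le> ?B"
  proof (rule tendsto_upperbound[OF lim])
    have "\<forall>\<^sub>F h in at_right 0. h \<in> {0<..<R}" by (rule eventually_at_right_real[OF R])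
    then show "\<forall>\<^sub>F h in at_right 0. \<bar>g h / h\<bar> \<le> ?B"
    proof eventually_elim
      case (elim h)
      have "g h \<le> h * ?B"
        unfolding g_def using elim by (intro reflection_estimate[OF R u lap M e]) auto
      moreover have "- g h \<le> h * ?B"
      proof -
        have "- u (c + h *\<^sub>R e) - - u (c - h *\<^sub>R e) \<le> h * ?B"
        proof (rule reflection_estimate[OF R _ _ _ e])
          fix x assume "x \<in> ball c R"
          then obtain L where "\<bar>L\<bar> \<le> K" "has_lap u L x" using lap by blast
          then show "\<exists>L. \<bar>L\<bar> \<le> K \<and> has_lap (\<lambda>x. - u x) L x"
            using has_lap_cmult[of u L x "-1"] by (intro exI[of _ "-L"]) auto
        qed (use elim u M in \<open>auto intro!: continuous_intros\<close>)
        then show ?thesis by (simp add: g_def)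
      qed
      ultimately have "\<bar>g h\<bar> \<le> ?B * h" by (simp add: abs_le_iff mult.commute)
      then show ?case using elim by (simp add: abs_divide pos_divide_le_eq)
    qed
  qed simp
  then show ?thesis by simp
qed

text \<open>Every point of \<open>cball c (R / 2)\<close> is the centre of a closed ball of radius
  \<open>R / 4\<close> inside the open ball, where \<open>partial_bound\<close> applies. Summing
  over coordinates costs the leading dimension factor, and the mean value inequality
  concludes.\<close>

lemma interior_lipschitz:
  fixes u :: "'a::euclidean_space \<Rightarrow> real"
  assumes R: "0 < R" and u: "\<And>x. x \<in> ball c R \<Longrightarrow> u differentiable (at x)"
    and lap: "\<And>x. x \<in> ball c R \<Longrightarrow> \<exists>L. \<bar>L\<bar> \<le> K \<and> has_lap u L x"
    and M: "\<And>x. x \<in> ball c R \<Longrightarrow> \<bar>u x\<bar> \<le> M"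
    and x: "norm (x - c) \<le> R / 2"
  shows "\<bar>u x - u c\<bar> \<le> real DIM('a) * (4 * real DIM('a) * M / R + K * R) * norm (x - c)"
proof -
  let ?n = "real DIM('a)"
  let ?B = "4 * ?n * M / R + K * R"
  have M0: "0 \<le> M" using M[of c] R by auto
  have K0: "0 \<le> K" using lap[of c] R by auto
  have "norm (u x - u c) \<le> ?n * ?B * norm (x - c)"
  proof (rule differentiable_bound[where S="cball c (R/2)"])
    fix y assume y: "y \<in> cball c (R/2)"
    then have yR: "y \<in> ball c R" using R by auto
    then have F: "(u has_derivative frechet_derivative u (at y)) (at y)"
      using u frechet_derivative_works by blast
    then show "(u has_derivative frechet_derivative u (at y)) (at y within cball c (R/2))"
      by (rule has_derivative_at_withinI)
    have sub: "cball y (R/4) \<subseteq> ball c R"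
    proof
      fix z assume "z \<in> cball y (R/4)"
      then show "z \<in> ball c R" using y R dist_triangle[of c z y] by auto
    qed
    have part: "\<bar>frechet_derivative u (at y) e\<bar> \<le> ?B" if e: "e \<in> Basis" for e
    proof -
      have "\<bar>frechet_derivative u (at y) e\<bar> \<le> ?n * M / (R/4) + K * (R/4) / 2"
      proof (rule partial_bound[OF _ _ _ _ F e])
        show "continuous_on (cball y (R/4)) u"
          by (rule differentiable_imp_continuous_on, unfold differentiable_on_def)
            (use sub u in \<open>blast intro: differentiable_at_withinI\<close>)
        show "0 < R / 4" using R by simp
        show "\<exists>L. \<bar>L\<bar> \<le> K \<and> has_lap u L z" if "z \<in> ball y (R/4)" for z
          using that sub ball_subset_cball[of y "R/4"] by (intro lap) blast
        show "\<bar>u z\<bar> \<le> M" if "z \<in> cball y (R/4)" for z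
          using that sub by (intro M) blast
      qed
      also have "\<dots> = 4 * ?n * M / R + K * R / 8" by simp
      also have "\<dots> \<le> ?B" using mult_nonneg_nonneg[of K R] K0 R by linarith
      finally show ?thesis .
    qed
    show "onorm (frechet_derivative u (at y)) \<le> ?n * ?B"
    proof (rule onorm_le)
      fix h :: 'a
      have lin: "linear (frechet_derivative u (at y))" by (rule has_derivative_linear[OF F])
      have "frechet_derivative u (at y) h = frechet_derivative u (at y) (\<Sum>e\<in>Basis. (h \<bullet> e) *\<^sub>R e)"
        by (simp add: euclidean_representation)
      also have "\<dots> = (\<Sum>e\<in>Basis. (h \<bullet> e) * frechet_derivative u (at y) e)"
        using lin by (simp add: linear_sum linear_cmul)
      finally have "norm (frechet_derivative u (at y) h) \<le> (\<Sum>e\<in>Basis. \<bar>(h \<bullet> e) * frechet_derivative u (at y) e\<bar>)"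
        by simp
      also have "\<dots> \<le> (\<Sum>e\<in>(Basis::'a set). norm h * ?B)"
        by (intro sum_mono) (auto simp: abs_mult intro!: mult_mono Basis_le_norm part)
      also have "\<dots> = ?n * ?B * norm h" by (simp add: mult.commute mult.left_commute)
      finally show "norm (frechet_derivative u (at y) h) \<le> ?n * ?B * norm h" .
    qed
  qed (use R x in \<open>auto simp: dist_norm norm_minus_commute\<close>)
  then show ?thesis by simp
qed

text \<open>Points \<open>y\<close> near \<open>x0\<close> are reached by balls of radius \<open>r\<close> internally tangent to \<open>ball z \<rho>\<close> at the
  projection of \<open>y\<close>. A chain of balls carries the lower bound from the neighbourhood of \<open>x\<close>
  into each of them.\<close>

lemma nontangential_hopf:
  fixes v :: "'a::euclidean_space \<Rightarrow> real"
  assumes x0: "norm (x0 - z) = \<rho>"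
    and v: "continuous_on (cball z \<rho>) v" "superharmonic_on (ball z \<rho> \<inter> ball x0 R) v"
    and nonneg: "\<And>y. y \<in> cball z \<rho> \<inter> ball x0 R \<Longrightarrow> 0 \<le> v y"
    and r: "0 < r" "3 * r < R" "2 * r \<le> \<rho>"
    and \<kappa>: "0 < \<kappa>" "\<kappa> \<le> 1 / 16" "4 \<le> real k * \<kappa>"
    and x: "norm (x - x0) \<le> r" "cball x (4 * (\<kappa> * r)) \<subseteq> ball z \<rho>"
    and m: "0 \<le> m" "\<And>y. y \<in> cball x (\<kappa> * r) \<Longrightarrow> m \<le> v y"
    and y: "y \<in> ball z \<rho>" "norm (y - x0) < r / 2"
  shows "m * exp (- 8 * real DIM('a) * real k) * exp (- 8 * real DIM('a)) * (8 * real DIM('a) / r) * (\<rho> - norm (y - z)) \<le> v y"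
proof -
  let ?n = "real DIM('a)"
  let ?D = "ball z \<rho> \<inter> ball x0 R"
  \<comment> \<open>The distance from \<open>y\<close> to the sphere about \<open>z\<close>; it is
    below \<open>r / 2\<close> because \<open>x0\<close> lies on that sphere.\<close>
  define \<tau> where "\<tau> = \<rho> - norm (y - z)"
  have \<tau>: "0 < \<tau>" "\<tau> < r / 2"
    using y x0 norm_triangle_ineq3[of "x0 - z" "y - z"] by (auto simp: \<tau>_def dist_norm norm_minus_commute)
  have nz: "norm (y - z) = \<rho> - \<tau>" "\<rho> - \<tau> > 0" using \<tau> r by (auto simp: \<tau>_def)
  define \<omega> where "\<omega> = (1 / norm (y - z)) *\<^sub>R (y - z)"
  have \<omega>: "norm \<omega> = 1" "y = z + (\<rho> - \<tau>) *\<^sub>R \<omega>" using nz by (auto simp: \<omega>_def)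
  \<comment> \<open>The centre of the ball of radius \<open>r\<close> that touches the large sphere
    at the radial projection of \<open>y\<close>; \<open>y\<close> lies on its radius, at depth
    \<tau>.\<close>
  define p where "p = z + (\<rho> - r) *\<^sub>R \<omega>"
  have pz: "norm (p - z) = \<rho> - r" using \<omega> r by (simp add: p_def)
  have "y - p = (r - \<tau>) *\<^sub>R \<omega>" unfolding p_def by (subst \<omega>(2)) (simp add: algebra_simps)
  then have yp: "norm (y - p) = r - \<tau>" using \<omega> \<tau> r by simp
  have px0: "norm (p - x0) \<le> 3 * r / 2"
    using norm_triangle_ineq[of "p - y" "y - x0"] yp y(2) \<tau> by (simp add: norm_minus_commute)
  have pD: "cball p s \<subseteq> ball z \<rho>" if "s < r" for s
  proof
    fix c assume "c \<in> cball p s"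
    then show "c \<in> ball z \<rho>"
      using norm_triangle_ineq[of "c - p" "p - z"] pz that by (simp add: dist_norm norm_minus_commute)
  qed
  have pR: "cball p r \<subseteq> ball x0 R"
  proof
    fix c assume "c \<in> cball p r"
    then show "c \<in> ball x0 R"
      using norm_triangle_ineq[of "c - p" "p - x0"] px0 r by (simp add: dist_norm norm_minus_commute)
  qed
  have pz': "cball p r \<subseteq> cball z \<rho>"
  proof
    fix c assume "c \<in> cball p r"
    then show "c \<in> cball z \<rho>"
      using norm_triangle_ineq[of "c - p" "p - z"] pz by (simp add: dist_norm norm_minus_commute)
  qed
  let ?m = "m * exp (- 8 * ?n * real k)"
  have \<kappa>r: "0 < \<kappa> * r" "4 * (\<kappa> * r) \<le> r / 4" using \<kappa> r by (auto simp: field_simps)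
  have "?m * exp (- 8 * ?n) * barrier p r y \<le> v y"
  proof (rule superharmonic_barrier_bound)
    show "continuous_on (cball p r) v" by (rule continuous_on_subset[OF v(1) pz'])
    have "ball p r \<subseteq> ball z \<rho>"
    proof
      fix c assume "c \<in> ball p r"
      then show "c \<in> ball z \<rho>" using pD[of "dist p c"] by auto
    qed
    then show "superharmonic_on (ball p r) v"
      using v(2) pR ball_subset_cball[of p r] unfolding superharmonic_on_def by blast
    show "0 \<le> v c" if "norm (c - p) = r" for c
      using that pz' pR by (intro nonneg) (auto simp: subset_iff dist_norm norm_minus_commute)
    show "?m \<le> v c" if c: "c \<in> cball p (r / 4)" for c
    proof (rule superharmonic_chain[where D="?D" and q=x and h="\<kappa> * r"])
      show "convex ?D" by (intro convex_Int convex_ball)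
      show "continuous_on ?D v" by (rule continuous_on_subset[OF v(1)]) auto
      show "superharmonic_on ?D v" by (rule v(2))
      show "\<And>y. y \<in> ?D \<Longrightarrow> 0 \<le> v y" by (intro nonneg) auto
      have "cball x (4 * (\<kappa> * r)) \<subseteq> ball x0 R"
      proof
        fix c assume "c \<in> cball x (4 * (\<kappa> * r))"
        then have "norm (c - x) \<le> 4 * (\<kappa> * r)" by (simp add: dist_norm norm_minus_commute)
        moreover have "norm (c - x0) \<le> norm (c - x) + norm (x - x0)"
          using norm_triangle_ineq[of "c - x" "x - x0"] by simp
        ultimately have "norm (c - x0) < R" using x(1) \<kappa>r r by linarith
        then show "c \<in> ball x0 R" by (simp add: dist_norm norm_minus_commute)
      qed
      then show "cball x (4 * (\<kappa> * r)) \<subseteq> ?D" using x(2) by blast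
      have "cball c (4 * (\<kappa> * r)) \<subseteq> cball p (r / 2)"
      proof
        fix w assume "w \<in> cball c (4 * (\<kappa> * r))"
        then show "w \<in> cball p (r / 2)" using c \<kappa>r dist_triangle[of p w c] by simp
      qed
      moreover have "cball p (r / 2) \<subseteq> ?D"
        using pD[of "r / 2"] pR r subset_cball[of "r / 2" r p] by auto
      ultimately show "cball c (4 * (\<kappa> * r)) \<subseteq> ?D" by blast
      \<comment> \<open>The three distances are at most \<open>r / 4\<close>,
        \<open>3 * r / 2\<close> and \<open>r\<close>; the hypothesis on \<open>k\<close> covers a
        total of \<open>4 * r\<close>.\<close>
      have "norm (c - x) \<le> norm (c - p) + (norm (p - x0) + norm (x0 - x))"
        using norm_triangle_ineq[of "c - p" "p - x"] norm_triangle_ineq[of "p - x0" "x0 - x"] by simp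
      also have "\<dots> \<le> 4 * r" using c px0 x r by (simp add: dist_norm norm_minus_commute)
      also have "\<dots> \<le> real k * \<kappa> * r" using \<kappa>(3) r by (intro mult_right_mono) auto
      finally show "norm (c - x) \<le> real k * (\<kappa> * r)" by simp
    qed (use \<kappa>r m in auto)
  qed (use r m yp \<tau> in \<open>auto simp: dist_norm norm_minus_commute\<close>)
  \<comment> \<open>Since \<open>norm (y - p) = r - \<tau>\<close>, the difference of squares is
    \<open>\<tau> * (2 * r - \<tau>)\<close>, at least \<open>r * \<tau>\<close>: the barrier grows
    linearly off the sphere.\<close>
  moreover have "8 * ?n / r * \<tau> \<le> barrier p r y"
  proof -
    have "8 * ?n / r * \<tau> = 8 * ?n / r\<^sup>2 * (r * \<tau>)" using r by (simp add: power2_eq_square)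
    also have "\<dots> \<le> 8 * ?n / r\<^sup>2 * (r\<^sup>2 - (norm (y - p))\<^sup>2)"
    proof (intro mult_left_mono)
      have "0 \<le> \<tau> * (r - \<tau>)" using \<tau> by simp
      then show "r * \<tau> \<le> r\<^sup>2 - (norm (y - p))\<^sup>2" unfolding yp by (simp add: power2_eq_square algebra_simps)
    qed simp
    also have "\<dots> \<le> barrier p r y" by (rule barrier_ge)
    finally show ?thesis .
  qed
  then have "?m * exp (- 8 * ?n) * (8 * ?n / r * \<tau>) \<le> ?m * exp (- 8 * ?n) * barrier p r y"
    using m by (intro mult_left_mono) auto
  ultimately show ?thesis unfolding \<tau>_def by (simp add: mult.assoc)
qed

section \<open>Convex domains and their positive eigenfunctions\<close>

text \<open>A supporting hyperplane at \<open>x0\<close> leaves the tangent ball on one side while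
  touching it at \<open>x0\<close>. This forces equality in the Cauchy-Schwarz inequality, so the
  normal is a positive multiple of \<open>z - x0\<close>.\<close>

lemma convex_inner_normal:
  fixes x0 z :: "'a::euclidean_space"
  assumes \<Omega>: "open \<Omega>" "convex \<Omega>" and x0: "x0 \<in> frontier \<Omega>"
    and ball: "ball z \<rho> \<subseteq> \<Omega>" "norm (x0 - z) = \<rho>" "0 < \<rho>" and y: "y \<in> closure \<Omega>"
  shows "0 \<le> (y - x0) \<bullet> (z - x0)"
proof -
  have "x0 \<in> closure \<Omega>" "x0 \<notin> rel_interior \<Omega>"
    using x0 \<Omega> by (auto simp: frontier_def rel_interior_open interior_open)
  then obtain a where a: "a \<noteq> 0" "\<And>y. y \<in> closure \<Omega> \<Longrightarrow> a \<bullet> x0 \<le> a \<bullet> y"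
    using supporting_hyperplane_relative_frontier[OF \<Omega>(2)] by metis
  have sub: "cball z \<rho> \<subseteq> closure \<Omega>"
    using closure_mono[OF ball(1)] ball(3) by (simp add: closure_ball)
  \<comment> \<open>The point of the closed ball that lies farthest in the direction
    \<open>- a\<close>.\<close>
  have "z - (\<rho> / norm a) *\<^sub>R a \<in> cball z \<rho>" using a ball(3) by (simp add: dist_norm)
  then have "a \<bullet> x0 \<le> a \<bullet> (z - (\<rho> / norm a) *\<^sub>R a)" using sub a(2) by blast
  also have "\<dots> = a \<bullet> z - \<rho> * norm a"
    using a(1) by (simp add: inner_simps power2_norm_eq_inner[symmetric] power2_eq_square)
  finally have "norm a * norm (z - x0) \<le> a \<bullet> (z - x0)"
    using ball(2) by (simp add: inner_simps norm_minus_commute mult.commute)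
  then have "a \<bullet> (z - x0) = norm a * norm (z - x0)"
    using norm_cauchy_schwarz[of a "z - x0"] by simp
  then have "norm a *\<^sub>R (z - x0) = norm (z - x0) *\<^sub>R a"
    by (simp add: norm_cauchy_schwarz_eq)
  then have "norm a * ((y - x0) \<bullet> (z - x0)) = \<rho> * ((y - x0) \<bullet> a)"
    using ball(2) by (metis inner_scaleR_right norm_minus_commute)
  moreover have "0 \<le> \<rho> * ((y - x0) \<bullet> a)"
    using a(2)[OF y] ball(3) by (simp add: inner_simps inner_commute)
  ultimately have "0 \<le> norm a * ((y - x0) \<bullet> (z - x0))" by argo
  then show ?thesis using a(1) by (simp add: zero_le_mult_iff)
qed

text \<open>The eigenvalue \<mu> is arbitrary here: positivity of \<open>u\<close> gives the signs
  that the comparisons use, and the minimality of the first eigenvalue is brought in later, with the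
  location of the maximum point.\<close>

locale positive_eigenfunction =
  fixes \<Omega> :: "'a::euclidean_space set" and \<mu> :: real and u :: "'a \<Rightarrow> real"
  assumes domain: "bounded_convex_domain \<Omega>"
    and eigenfunction: "dirichlet_eigenfunction \<Omega> \<mu> u"
    and positive: "\<And>x. x \<in> \<Omega> \<Longrightarrow> 0 < u x"
begin

lemma open_domain: "open \<Omega>" and bounded_domain: "bounded \<Omega>"
  and convex_domain: "convex \<Omega>" and domain_nonempty: "\<Omega> \<noteq> {}"
  using domain by (auto simp: bounded_convex_domain_def)

lemma continuous_closure: "continuous_on (closure \<Omega>) u"
  and zero_on_frontier: "x \<in> frontier \<Omega> \<Longrightarrow> u x = 0"
  and differentiable: "x \<in> \<Omega> \<Longrightarrow> u differentiable (at x)"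
  using eigenfunction by (auto simp: dirichlet_eigenfunction_def C2_on_def)

lemma compact_closure: "compact (closure \<Omega>)"
  using bounded_domain by simp

lemma closure_eq: "closure \<Omega> = \<Omega> \<union> frontier \<Omega>"
  by (simp add: closure_Un_frontier)

lemma nonneg: "x \<in> closure \<Omega> \<Longrightarrow> 0 \<le> u x"
  unfolding closure_eq using positive zero_on_frontier by fastforce

lemma lap_eq: "x \<in> \<Omega> \<Longrightarrow> has_lap u (- (\<mu> * u x)) x"
  using C2_on_has_lap[OF _ open_domain, of u x] eigenfunction
  unfolding dirichlet_eigenfunction_def by (metis minus_minus)

lemma subset_interior_closure: "\<Omega> \<subseteq> interior (closure \<Omega>)"
  by (simp add: closure_subset interior_maximal open_domain)

text \<open>Otherwise \<open>- u\<close> would be superharmonic with zero boundary values, hence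
  nonnegative. The sign has to be proved, since the first eigenvalue is defined as an infimum of
  reals.\<close>

lemma eigenvalue_pos: "0 < \<mu>"
proof (rule ccontr)
  assume "\<not> 0 < \<mu>"
  then have \<mu>: "\<mu> \<le> 0" by simp
  obtain x where x: "x \<in> \<Omega>" using domain_nonempty by blast
  have "0 \<le> - u x"
  proof (rule minimum_principle[OF compact_closure])
    show "continuous_on (closure \<Omega>) (\<lambda>x. - u x)" by (intro continuous_intros continuous_closure)
    show "x \<in> closure \<Omega>" using x closure_subset by blast
    fix y assume "y \<in> closure \<Omega>" "- u y < 0"
    then have y: "y \<in> \<Omega>" unfolding closure_eq using zero_on_frontier by force
    have "has_lap (\<lambda>x. - u x) (\<mu> * u y) y" using has_lap_cmult[OF lap_eq[OF y], of "-1"] by simp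
    moreover have "\<mu> * u y \<le> 0" using \<mu> positive[OF y] by (simp add: mult_nonpos_nonneg)
    ultimately show "y \<in> interior (closure \<Omega>) \<and> (\<exists>L\<le>0. has_lap (\<lambda>x. - u x) L y)"
      using y subset_interior_closure by blast
  qed
  then show False using positive[OF x] by simp
qed

lemma superharmonic: "superharmonic_on \<Omega> u"
  unfolding superharmonic_on_def
proof
  fix x assume x: "x \<in> \<Omega>"
  show "\<exists>L\<le>0. has_lap u L x"
    using lap_eq[OF x] eigenvalue_pos positive[OF x]
    by (intro exI[of _ "- (\<mu> * u x)"]) auto
qed

lemma maximum_point:
  obtains a where "a \<in> \<Omega>" "\<And>y. y \<in> closure \<Omega> \<Longrightarrow> u y \<le> u a"
proof -
  obtain a where a: "a \<in> closure \<Omega>" "\<And>y. y \<in> closure \<Omega> \<Longrightarrow> u y \<le> u a"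
    using continuous_attains_sup[OF compact_closure _ continuous_closure] domain_nonempty by auto
  obtain x where x: "x \<in> \<Omega>" using domain_nonempty by blast
  then have "0 < u a" using positive[OF x] a(2)[of x] closure_subset by force
  then have "a \<in> \<Omega>" using a(1) zero_on_frontier unfolding closure_eq by force
  then show ?thesis using that a by blast
qed

lemma lap_bound:
  assumes "\<And>y. y \<in> closure \<Omega> \<Longrightarrow> u y \<le> M" "x \<in> \<Omega>"
  shows "\<exists>L. \<bar>L\<bar> \<le> \<mu> * M \<and> has_lap u L x"
proof -
  have "u x \<le> M" using assms closure_subset by blast
  then show ?thesis
    using lap_eq[OF assms(2)] eigenvalue_pos positive[OF assms(2)]
    by (intro exI[of _ "- (\<mu> * u x)"]) auto
qed

text \<open>Being bounded, the domain lies in a slab \<open>0 \<le> s \<le> W\<close>, where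
  \<open>s\<close> is the inner product with \<nu>. The concave parabola
  \<open>K * s * (W - s)\<close> is nonnegative there, and \<open>K\<close> makes its Laplacian
  equal to \<open>- \<mu> * u a\<close>, at most that of \<open>u\<close>; so it dominates
  \<open>u\<close>, and it is at most linear in \<open>s\<close>.\<close>

lemma slab_bound:
  assumes half: "\<And>y. y \<in> closure \<Omega> \<Longrightarrow> 0 \<le> (y - x0) \<bullet> \<nu>" and \<nu>: "\<nu> \<noteq> 0"
  obtains C where "0 < C" "\<And>y. y \<in> closure \<Omega> \<Longrightarrow> u y \<le> C * ((y - x0) \<bullet> \<nu>)"
proof -
  obtain a where a: "a \<in> \<Omega>" "\<And>y. y \<in> closure \<Omega> \<Longrightarrow> u y \<le> u a" using maximum_point by blast
  obtain B where B: "B > 0" "\<And>y. y \<in> closure \<Omega> \<Longrightarrow> norm (y - x0) \<le> B"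
  proof -
    have "bounded ((\<lambda>y. y - x0) ` closure \<Omega>)"
      by (intro compact_imp_bounded compact_continuous_image continuous_intros compact_closure)
    then show ?thesis using that unfolding bounded_pos by auto
  qed
  define W where "W = B * norm \<nu>"
  have W: "(y - x0) \<bullet> \<nu> \<le> W" if "y \<in> closure \<Omega>" for y
    using norm_cauchy_schwarz[of "y - x0" \<nu>] mult_right_mono[OF B(2)[OF that], of "norm \<nu>"]
    by (simp add: W_def)
  have W0: "0 < W" using B \<nu> by (simp add: W_def)
  define K where "K = \<mu> * u a / (2 * (norm \<nu>)\<^sup>2)"
  have K0: "0 < K" using eigenvalue_pos positive[OF a(1)] \<nu> by (simp add: K_def)
  define \<psi> where "\<psi> y = 0 * (norm (y - x0))\<^sup>2 + (K * W) * ((y - x0) \<bullet> \<nu>) + (- K) * ((y - x0) \<bullet> \<nu>)\<^sup>2 + 0" for y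
  have \<psi>_eq: "\<psi> y = K * ((y - x0) \<bullet> \<nu>) * (W - (y - x0) \<bullet> \<nu>)" for y
    by (simp add: \<psi>_def power2_eq_square algebra_simps)
  have \<psi>0: "0 \<le> \<psi> y" if "y \<in> closure \<Omega>" for y
    using half[OF that] W[OF that] K0 by (simp add: \<psi>_eq)
  have "u y \<le> \<psi> y" if y: "y \<in> closure \<Omega>" for y
  proof -
    have "0 \<le> \<psi> y - u y"
    proof (rule minimum_principle[OF compact_closure _ _ y])
      show "continuous_on (closure \<Omega>) (\<lambda>y. \<psi> y - u y)"
        unfolding \<psi>_def by (intro continuous_intros continuous_closure)
      fix y assume y: "y \<in> closure \<Omega>" "\<psi> y - u y < 0"
      then have y': "y \<in> \<Omega>" using \<psi>0[OF y(1)] zero_on_frontier unfolding closure_eq by force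
      have "has_lap (\<lambda>y. \<psi> y - u y) ((2 * real DIM('a) * 0 + 2 * (-K) * (norm \<nu>)\<^sup>2) - (- (\<mu> * u y))) y"
        unfolding \<psi>_def by (intro has_lap_diff has_lap_quadratic lap_eq y')
      moreover have "(2 * real DIM('a) * 0 + 2 * (-K) * (norm \<nu>)\<^sup>2) - (- (\<mu> * u y)) \<le> 0"
        using \<nu> a(2)[OF y(1)] eigenvalue_pos by (simp add: K_def)
      ultimately show "y \<in> interior (closure \<Omega>) \<and> (\<exists>L\<le>0. has_lap (\<lambda>y. \<psi> y - u y) L y)"
        using y' subset_interior_closure by blast
    qed
    then show ?thesis by simp
  qed
  moreover have "\<psi> y \<le> K * W * ((y - x0) \<bullet> \<nu>)" for y
    using K0 by (simp add: \<psi>_def)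
  ultimately show ?thesis using that[of "K * W"] K0 W0 by (meson mult_pos_pos order_trans)
qed

end

section \<open>Differentiability at the boundary\<close>

text \<open>Relates the radial variable of \<open>barrier\<close> to the height above the tangent
  plane at \<open>x0\<close>, with a quadratic error.\<close>

lemma sq_dist_from_center:
  fixes x x0 z :: "'a::real_inner"
  assumes "norm (x0 - z) = \<rho>"
  shows "\<rho>\<^sup>2 - (norm (x - z))\<^sup>2 = 2 * ((x - x0) \<bullet> (z - x0)) - (norm (x - x0))\<^sup>2"
proof -
  have "x - z = (x - x0) - (z - x0)" by simp
  then have "(norm (x - z))\<^sup>2 = (norm (x - x0))\<^sup>2 - 2 * ((x - x0) \<bullet> (z - x0)) + (norm (z - x0))\<^sup>2"
    by (simp only: power2_norm_eq_inner) (simp add: inner_diff inner_commute)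
  then show ?thesis using assms by (simp add: norm_minus_commute)
qed

text \<open>Uses \<open>exp Y - 1 \<le> Y + Y\<^sup>2\<close> for \<open>Y\<close> between 0 and 1.
  With \<open>barrier_ge\<close> it identifies the linear part of the barrier at
  \<open>x0\<close>.\<close>

lemma barrier_upper:
  fixes x z :: "'a::euclidean_space"
  assumes x0: "norm (x0 - z) = \<rho>" and \<alpha>: "\<alpha> = 8 * real DIM('a) / \<rho>\<^sup>2"
    and x: "norm (x - z) \<le> \<rho>" and r: "2 * \<alpha> * \<rho> * norm (x - x0) \<le> 1"
  shows "barrier z \<rho> x \<le> 2 * \<alpha> * ((x - x0) \<bullet> (z - x0)) + (2 * \<alpha> * \<rho> * norm (x - x0))\<^sup>2"
proof -
  let ?Y = "\<alpha> * (\<rho>\<^sup>2 - (norm (x - z))\<^sup>2)"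
  have \<alpha>0: "0 \<le> \<alpha>" by (simp add: \<alpha>)
  have s: "(x - x0) \<bullet> (z - x0) \<le> \<rho> * norm (x - x0)"
    using norm_cauchy_schwarz[of "x - x0" "z - x0"] x0 by (simp add: norm_minus_commute mult.commute)
  have Y: "?Y = 2 * \<alpha> * ((x - x0) \<bullet> (z - x0)) - \<alpha> * (norm (x - x0))\<^sup>2"
    unfolding sq_dist_from_center[OF x0] by (simp add: algebra_simps)
  have Y1: "?Y \<le> 2 * \<alpha> * ((x - x0) \<bullet> (z - x0))" using \<alpha>0 by (simp add: Y)
  also have "\<dots> \<le> 2 * \<alpha> * (\<rho> * norm (x - x0))" by (intro mult_left_mono s) (use \<alpha>0 in auto)
  finally have Y2: "?Y \<le> 2 * \<alpha> * \<rho> * norm (x - x0)" by (simp add: mult.assoc)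
  have Y0: "0 \<le> ?Y" using \<alpha>0 x by (simp add: power_mono)
  have "barrier z \<rho> x = exp ?Y - 1" by (simp add: barrier_def \<alpha>)
  also have "\<dots> \<le> ?Y + ?Y\<^sup>2" using exp_bound[OF Y0] Y2 r by linarith
  also have "\<dots> \<le> 2 * \<alpha> * ((x - x0) \<bullet> (z - x0)) + (2 * \<alpha> * \<rho> * norm (x - x0))\<^sup>2"
    by (intro add_mono Y1 power_mono Y2 Y0)
  finally show ?thesis .
qed

context positive_eigenfunction
begin

text \<open>The gain \<open>c\<close> is chosen before the slope \<open>a\<close> and the radius
  \<open>R\<close>; this uniformity is what contradicts a supremum of slopes. The new radius
  \<open>R'\<close> may shrink freely, since slopes are tested only near \<open>x0\<close>.\<close>

lemma barrier_slope_improves: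
  fixes x0 z :: 'a and \<rho> A \<eta> :: real
  defines "\<alpha> \<equiv> 8 * real DIM('a) / \<rho>\<^sup>2"
  assumes \<rho>: "0 < \<rho>" and ball: "ball z \<rho> \<subseteq> \<Omega>" and x0: "norm (x0 - z) = \<rho>"
    and half: "\<And>y. y \<in> closure \<Omega> \<Longrightarrow> 0 \<le> (y - x0) \<bullet> (z - x0)"
    and A: "0 \<le> A" and \<eta>: "0 < \<eta>"
    and bad: "\<And>d. 0 < d \<Longrightarrow> \<exists>x\<in>closure \<Omega>. norm (x - x0) < d \<and>
        2 * \<alpha> * A * ((x - x0) \<bullet> (z - x0)) + \<eta> * norm (x - x0) < u x"
  obtains c where "0 < c"
    "\<And>a R. 0 \<le> a \<Longrightarrow> a \<le> A \<Longrightarrow> 0 < R \<Longrightarrow>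
        (\<And>x. x \<in> ball z \<rho> \<inter> ball x0 R \<Longrightarrow> a * barrier z \<rho> x \<le> u x) \<Longrightarrow>
        \<exists>R'>0. \<forall>x\<in>ball z \<rho> \<inter> ball x0 R'. (a + c) * barrier z \<rho> x \<le> u x"
proof -
  let ?n = "real DIM('a)"
  have n: "?n \<ge> 1" using DIM_positive[where 'a='a] by linarith
  have \<alpha>0: "0 < \<alpha>" using \<rho> n by (simp add: \<alpha>_def)
  define s where "s x = (x - x0) \<bullet> (z - x0)" for x
  have zx0: "norm (z - x0) = \<rho>" using x0 by (simp add: norm_minus_commute)
  have s_le: "s x \<le> \<rho> * norm (x - x0)" for x
    using norm_cauchy_schwarz[of "x - x0" "z - x0"] zx0 by (simp add: s_def mult.commute)
  have s_diff: "\<bar>s y - s x\<bar> \<le> \<rho> * norm (y - x)" for x y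
  proof -
    have "s y - s x = (y - x) \<bullet> (z - x0)" by (simp add: s_def inner_simps)
    then show ?thesis using Cauchy_Schwarz_ineq2[of "y - x" "z - x0"] zx0 by (simp add: mult.commute)
  qed
  have in_ball: "x \<in> ball z \<rho>" if "(norm (x - x0))\<^sup>2 < 2 * s x" for x
  proof -
    have "0 < \<rho>\<^sup>2 - (norm (x - z))\<^sup>2" using that sq_dist_from_center[OF x0, of x] by (simp add: s_def)
    then show ?thesis using \<rho> by (simp add: dist_norm norm_minus_commute power_less_imp_less_base)
  qed
  have "z \<noteq> x0" using zx0 \<rho> by auto
  then obtain C where C: "0 < C" "\<And>y. y \<in> closure \<Omega> \<Longrightarrow> u y \<le> C * s y"
    using slab_bound[OF half] unfolding s_def by (metis right_minus_eq)
  obtain a0 where a0: "a0 \<in> \<Omega>" "\<And>y. y \<in> closure \<Omega> \<Longrightarrow> u y \<le> u a0" using maximum_point by blast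
  define K where "K = \<mu> * u a0"
  have K0: "0 < K" using eigenvalue_pos positive[OF a0(1)] by (simp add: K_def)
  define g where "g = 2 * \<alpha> * A"
  have g0: "0 \<le> g" using \<alpha>0 A by (simp add: g_def)
  \<comment> \<open>The aperture of the cone that contains the bad points: they satisfy
    \<open>s x \<ge> \<delta> * \<rho> * norm (x - x0)\<close>.\<close>
  define \<delta> where "\<delta> = min 1 (\<eta> / (C * \<rho>))"
  have \<delta>: "0 < \<delta>" "\<delta> \<le> 1" "\<delta> * (C * \<rho>) \<le> \<eta>" using C \<eta> \<rho> by (auto simp: \<delta>_def min_def field_simps)
  \<comment> \<open>The Lipschitz constant near a bad point at distance \<open>r\<close>. On a ball
    of radius \<open>\<delta> * r / 2\<close> the slab bound gives values up to
    \<open>2 * C * \<rho> * r\<close>, so \<open>r\<close> cancels in the quotient.\<close>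
  define L where "L = ?n * (16 * ?n * C * \<rho> / \<delta> + K)"
  have L0: "0 < L" using n C \<rho> \<delta> K0 by (simp add: L_def add_pos_pos)
  \<comment> \<open>The first bound keeps the starting ball and its fourfold enlargement inside the
    region of the Lipschitz estimate; the second limits the combined variation of \<open>u\<close>
    and of the linear function to \<open>\<eta> / 4 * r\<close>.\<close>
  define \<kappa> where "\<kappa> = min (\<delta> / 16) (\<eta> / (4 * (L + g * \<rho>)))"
  have Lg: "0 < L + g * \<rho>" using L0 g0 \<rho> by (simp add: add_pos_nonneg)
  have \<kappa>: "0 < \<kappa>" "\<kappa> \<le> \<delta> / 16" "(L + g * \<rho>) * \<kappa> \<le> \<eta> / 4"
  proof -
    show "0 < \<kappa>" using \<delta> \<eta> Lg by (auto simp: \<kappa>_def)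
    show "\<kappa> \<le> \<delta> / 16" unfolding \<kappa>_def by (rule min.cobounded1)
    have "(L + g * \<rho>) * \<kappa> \<le> (L + g * \<rho>) * (\<eta> / (4 * (L + g * \<rho>)))"
      unfolding \<kappa>_def using Lg by (intro mult_left_mono min.cobounded2) auto
    also have "\<dots> = \<eta> / 4" using Lg nonzero_mult_div_cancel_left[of "L + g * \<rho>" "\<eta> / 4"] by simp
    finally show "(L + g * \<rho>) * \<kappa> \<le> \<eta> / 4" .
  qed
  define k where "k = nat \<lceil>4 / \<kappa>\<rceil>"
  have k: "4 \<le> real k * \<kappa>"
  proof -
    have "4 / \<kappa> \<le> real k" unfolding k_def by (rule real_nat_ceiling_ge)
    then show ?thesis using \<kappa>(1) by (simp add: field_simps)
  qed
  define c2 where "c2 = \<eta> / 2 * exp (- 8 * ?n * real k) * exp (- 8 * ?n) * (8 * ?n)"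
  have c2: "0 < c2" using \<eta> n by (simp add: c2_def)
  \<comment> \<open>The Hopf bound will be \<open>c2\<close> times the distance to the sphere, and
    the barrier is at most \<open>4 * \<alpha> * \<rho>\<close> times that distance.\<close>
  define c where "c = c2 / (4 * \<alpha> * \<rho>)"
  have c: "0 < c" using c2 \<alpha>0 \<rho> by (simp add: c_def)
  define Q where "Q = A * (4 * \<alpha> * \<rho>)\<^sup>2"
  have Q0: "0 \<le> Q" using A by (simp add: Q_def)
  have main: "\<exists>R'>0. \<forall>x\<in>ball z \<rho> \<inter> ball x0 R'. (a + c) * barrier z \<rho> x \<le> u x"
    if a: "0 \<le> a" "a \<le> A" and R: "0 < R" and aR: "\<And>x. x \<in> ball z \<rho> \<inter> ball x0 R \<Longrightarrow> a * barrier z \<rho> x \<le> u x" for a R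
  proof -
    \<comment> \<open>Within \<open>\<rho> / 2\<close> of \<open>x0\<close> all points stay outside
      the core of the barrier, where it may fail to be subharmonic.\<close>
    define R1 where "R1 = min R (\<rho> / 2)"
    have R1: "0 < R1" "R1 \<le> R" "R1 \<le> \<rho> / 2" using R \<rho> by (auto simp: R1_def)
    \<comment> \<open>In order, the terms give room for the tangent balls, place a ball about the
      bad point inside \<open>ball z \<rho>\<close>, bound the Laplacian term in the Lipschitz
      constant, keep the exponent of the barrier at most 1, and make its quadratic error at most
      \<open>\<eta> / 4 * r\<close>.\<close>
    define d where "d = Min {R1 / 3, \<delta> * \<rho> / 4, 1, 1 / (4 * \<alpha> * \<rho>), \<eta> / (4 * (1 + Q))}"
    have "0 < d" using R1 \<delta> \<rho> \<alpha>0 \<eta> Q0 by (simp add: d_def)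
    then obtain x where x: "x \<in> closure \<Omega>" "norm (x - x0) < d" "g * s x + \<eta> * norm (x - x0) < u x"
      using bad[of d] unfolding g_def s_def by blast
    define r where "r = norm (x - x0)"
    have "r < R1 / 3 \<and> r < \<delta> * \<rho> / 4 \<and> r < 1 \<and> r < 1 / (4 * \<alpha> * \<rho>) \<and> r < \<eta> / (4 * (1 + Q))"
      using x(2) unfolding d_def r_def by simp
    then have r: "3 * r < R1" "4 * r < \<delta> * \<rho>" "r < 1" "4 * \<alpha> * \<rho> * r < 1" "r * (4 * (1 + Q)) < \<eta>"
      using \<alpha>0 \<rho> Q0 by (auto simp: field_simps)
    have sx0: "0 \<le> s x" using half[OF x(1)] by (simp add: s_def)
    have "x \<noteq> x0"
    proof
      assume "x = x0"
      then show False using x(3) C(2)[OF x(1)] by (simp add: s_def)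
    qed
    then have r0: "0 < r" by (simp add: r_def)
    have sx: "\<delta> * \<rho> * r \<le> s x"
    proof -
      have "C * (\<delta> * \<rho> * r) \<le> \<eta> * r"
        using mult_right_mono[OF \<delta>(3), of r] r0 by (simp add: algebra_simps)
      also have "\<dots> \<le> g * s x + \<eta> * r" using g0 sx0 by simp
      also have "\<dots> \<le> C * s x" using x(3) C(2)[OF x(1)] by (simp add: r_def)
      finally show ?thesis using C(1) by simp
    qed
    have near: "norm (y - x0) \<le> 2 * r" "s y \<le> 2 * \<rho> * r" "y \<in> ball z \<rho>"
      if y: "y \<in> ball x (\<delta> * r / 2)" for y
    proof -
      have yx: "norm (y - x) < \<delta> * r / 2" using y by (simp add: dist_norm norm_minus_commute)
      also have "\<dots> \<le> r" using \<delta> r0 mult_right_mono[OF \<delta>(2), of r] by simp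
      finally show y1: "norm (y - x0) \<le> 2 * r"
        using norm_triangle_ineq[of "y - x" "x - x0"] by (simp add: r_def)
      show "s y \<le> 2 * \<rho> * r"
        using order_trans[OF s_le[of y] mult_left_mono[OF y1, of \<rho>]] \<rho> by (simp add: algebra_simps)
      have "\<rho> * norm (y - x) \<le> \<rho> * (\<delta> * r / 2)" using yx \<rho> by (intro mult_left_mono) auto
      then have s2: "\<delta> * \<rho> * r / 2 \<le> s y" using sx s_diff[of y x] by (simp add: algebra_simps)
      have "(norm (y - x0))\<^sup>2 \<le> (2 * r)\<^sup>2" by (intro power_mono y1) auto
      also have "\<dots> = 4 * r * r" by (simp add: power2_eq_square)
      also have "\<dots> < \<delta> * \<rho> * r" using r(2) r0 by (intro mult_strict_right_mono) auto
      also have "\<dots> \<le> 2 * s y" using s2 by simp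
      finally show "y \<in> ball z \<rho>" by (rule in_ball)
    qed
    have near': "y \<in> closure \<Omega>" "y \<in> \<Omega>" if "y \<in> ball x (\<delta> * r / 2)" for y
      using near(3)[OF that] ball closure_subset by blast+
    have lip: "\<bar>u y - u x\<bar> \<le> L * norm (y - x)" if y: "norm (y - x) \<le> \<delta> * r / 2 / 2" for y
    proof -
      have "\<bar>u y - u x\<bar> \<le> ?n * (4 * ?n * (2 * C * \<rho> * r) / (\<delta> * r / 2) + K * (\<delta> * r / 2)) * norm (y - x)"
      proof (rule interior_lipschitz[OF _ _ _ _ y])
        show "0 < \<delta> * r / 2" using \<delta> r0 by simp
        fix w assume w: "w \<in> ball x (\<delta> * r / 2)"
        show "u differentiable (at w)" by (rule differentiable[OF near'(2)[OF w]])
        show "\<exists>L. \<bar>L\<bar> \<le> K \<and> has_lap u L w" unfolding K_def by (rule lap_bound[OF a0(2) near'(2)[OF w]])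
        have "u w \<le> C * s w" by (rule C(2)[OF near'(1)[OF w]])
        also have "\<dots> \<le> C * (2 * \<rho> * r)" using near(2)[OF w] C(1) by (intro mult_left_mono) auto
        finally show "\<bar>u w\<bar> \<le> 2 * C * \<rho> * r" using nonneg[OF near'(1)[OF w]] by (simp add: algebra_simps)
      qed
      also have "\<dots> \<le> L * norm (y - x)"
      proof (intro mult_right_mono)
        have "K * (\<delta> * r / 2) \<le> K * 1" 
        proof (intro mult_left_mono)
          have "\<delta> * r \<le> 1 * 1" using \<delta> r r0 by (intro mult_mono) auto
          then show "\<delta> * r / 2 \<le> 1" by simp
        qed (use K0 in auto)
        moreover have "4 * ?n * (2 * C * \<rho> * r) / (\<delta> * r / 2) = 16 * ?n * C * \<rho> / \<delta>"
          using r0 \<delta> by (simp add: field_simps)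
        ultimately show "?n * (4 * ?n * (2 * C * \<rho> * r) / (\<delta> * r / 2) + K * (\<delta> * r / 2)) \<le> L"
          unfolding L_def by (intro mult_left_mono) auto
      qed auto
      finally show ?thesis .
    qed
    define v where "v y = u y - a * barrier z \<rho> y" for y
    have sub: "cball z \<rho> \<subseteq> closure \<Omega>"
      using closure_mono[OF ball] \<rho> by (simp add: closure_ball)
    have \<kappa>r: "\<kappa> * r \<le> \<delta> * r / 16" using \<kappa>(2) r0 by (simp add: mult_right_mono)
    \<comment> \<open>Of the excess \<open>\<eta> * r\<close> at \<open>x\<close>, one quarter pays
      for moving from \<open>x\<close> to \<open>y\<close> and one quarter for the quadratic error
      of the barrier; half remains.\<close>
    have v_low: "\<eta> / 2 * r \<le> v y" if y: "y \<in> cball x (\<kappa> * r)" for y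
    proof -
      have yx: "norm (y - x) \<le> \<kappa> * r" using y by (simp add: dist_norm norm_minus_commute)
      have \<delta>r: "0 < \<delta> * r" using \<delta> r0 by simp
      have yn: "y \<in> ball x (\<delta> * r / 2)" using y \<kappa>r \<delta>r by simp
      have "u x - u y \<le> L * norm (y - x)" using lip[of y] yx \<kappa>r \<delta>r by simp
      also have "\<dots> \<le> L * (\<kappa> * r)" using yx L0 by (intro mult_left_mono) auto
      finally have 1: "u x - u y \<le> L * (\<kappa> * r)" .
      have small: "2 * \<alpha> * \<rho> * norm (y - x0) \<le> 4 * \<alpha> * \<rho> * r"
        using mult_left_mono[OF near(1)[OF yn], of "2 * \<alpha> * \<rho>"] \<alpha>0 \<rho> by simp
      have "barrier z \<rho> y \<le> 2 * \<alpha> * s y + (2 * \<alpha> * \<rho> * norm (y - x0))\<^sup>2"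
        unfolding s_def
        by (rule barrier_upper[OF x0]) (use near(3)[OF yn] small r in \<open>auto simp: \<alpha>_def dist_norm norm_minus_commute\<close>)
      also have "(2 * \<alpha> * \<rho> * norm (y - x0))\<^sup>2 \<le> (4 * \<alpha> * \<rho> * r)\<^sup>2"
        using \<alpha>0 \<rho> by (intro power_mono small) auto
      finally have "barrier z \<rho> y \<le> 2 * \<alpha> * s y + (4 * \<alpha> * \<rho> * r)\<^sup>2" by simp
      then have "A * barrier z \<rho> y \<le> A * (2 * \<alpha> * s y + (4 * \<alpha> * \<rho> * r)\<^sup>2)" using A by (intro mult_left_mono)
      moreover have "a * barrier z \<rho> y \<le> A * barrier z \<rho> y"
        using near(3)[OF yn] a by (intro mult_right_mono barrier_nonneg) (auto simp: dist_norm norm_minus_commute)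
      ultimately have "a * barrier z \<rho> y \<le> A * (2 * \<alpha> * s y + (4 * \<alpha> * \<rho> * r)\<^sup>2)" by linarith
      also have "\<dots> = g * s y + Q * r * r" by (simp add: g_def Q_def power2_eq_square algebra_simps)
      also have "g * s y \<le> g * (s x + \<rho> * (\<kappa> * r))"
      proof (intro mult_left_mono g0)
        have "\<rho> * norm (y - x) \<le> \<rho> * (\<kappa> * r)" using yx \<rho> by (intro mult_left_mono) auto
        then show "s y \<le> s x + \<rho> * (\<kappa> * r)" using s_diff[of y x] by linarith
      qed
      finally have 2: "a * barrier z \<rho> y \<le> g * s x + g * \<rho> * (\<kappa> * r) + Q * r * r" by (simp add: algebra_simps)
      have 3: "(L + g * \<rho>) * \<kappa> * r \<le> \<eta> / 4 * r" using \<kappa>(3) r0 by (intro mult_right_mono) auto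
      have "Q * r \<le> \<eta> / 4" using r(5) r0 by (simp add: algebra_simps)
      then have 4: "Q * r * r \<le> \<eta> / 4 * r" using r0 by (intro mult_right_mono) auto
      show ?thesis unfolding v_def using 1 2 3 4 x(3) by (simp add: r_def algebra_simps)
    qed
    have v_nonneg: "0 \<le> v y" if y: "y \<in> cball z \<rho> \<inter> ball x0 R1" for y
    proof (cases "norm (y - z) = \<rho>")
      case True
      then show ?thesis using y sub nonneg barrier_sphere[OF True] by (auto simp: v_def)
    next
      case False
      then have "y \<in> ball z \<rho> \<inter> ball x0 R" using y R1 by (auto simp: dist_norm norm_minus_commute)
      then show ?thesis using aR by (simp add: v_def)
    qed
    have v_super: "superharmonic_on (ball z \<rho> \<inter> ball x0 R1) v"
      unfolding superharmonic_on_def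
    proof
      fix y assume y: "y \<in> ball z \<rho> \<inter> ball x0 R1"
      have "norm (x0 - z) \<le> norm (x0 - y) + norm (y - z)"
        using norm_triangle_ineq[of "x0 - y" "y - z"] by simp
      then have "\<rho> / 4 \<le> norm (y - z)" using y x0 R1 \<rho> by (simp add: dist_norm)
      then obtain L1 where L1: "0 \<le> L1" "has_lap (barrier z \<rho>) L1 y" using has_lap_barrier[OF \<rho>] by blast
      obtain L2 where L2: "L2 \<le> 0" "has_lap u L2 y"
        using superharmonic y ball unfolding superharmonic_on_def by blast
      have "has_lap v (L2 - a * L1) y"
        unfolding v_def[abs_def] by (intro has_lap_diff has_lap_cmult L1 L2)
      moreover have "L2 - a * L1 \<le> 0" using L1 L2 a mult_nonneg_nonneg[of a L1] by linarith
      ultimately show "\<exists>L\<le>0. has_lap v L y" by blast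
    qed
    show ?thesis
    proof (intro exI[of _ "r / 2"] conjI ballI)
      show "0 < r / 2" using r0 by simp
      fix y assume y: "y \<in> ball z \<rho> \<inter> ball x0 (r / 2)"
      define \<tau> where "\<tau> = \<rho> - norm (y - z)"
      have yr: "norm (y - x0) < r / 2" using y by (simp add: dist_norm norm_minus_commute)
      have \<tau>0: "0 < \<tau>" using y by (simp add: \<tau>_def dist_norm norm_minus_commute)
      have \<tau>r: "\<tau> \<le> r / 2"
        using yr norm_triangle_ineq[of "x0 - y" "y - z"] x0 by (simp add: \<tau>_def norm_minus_commute)
      have "\<eta> / 2 * r * exp (- 8 * ?n * real k) * exp (- 8 * ?n) * (8 * ?n / r) * (\<rho> - norm (y - z)) \<le> v y"
      proof (rule nontangential_hopf[OF x0 _ v_super v_nonneg r0 r(1)])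
        show "continuous_on (cball z \<rho>) v"
          unfolding v_def[abs_def] using continuous_on_subset[OF continuous_closure sub]
          by (intro continuous_intros continuous_on_barrier)
        show "2 * r \<le> \<rho>" using r R1 by simp
        show "\<kappa> \<le> 1 / 16" using \<kappa> \<delta> by simp
        show "cball x (4 * (\<kappa> * r)) \<subseteq> ball z \<rho>"
        proof
          fix w assume w: "w \<in> cball x (4 * (\<kappa> * r))"
          have "0 < \<delta> * r" using \<delta> r0 by simp
          then have "w \<in> ball x (\<delta> * r / 2)" using w \<kappa>r by simp
          then show "w \<in> ball z \<rho>" by (rule near(3))
        qed
      qed (use \<kappa> k y yr \<eta> r0 v_low in \<open>auto simp: r_def\<close>)
      then have v1: "c2 * \<tau> \<le> v y" using r0 by (simp add: c2_def \<tau>_def)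
      let ?Y = "\<alpha> * (\<rho>\<^sup>2 - (norm (y - z))\<^sup>2)"
      have "?Y \<le> \<alpha> * (2 * \<rho> * \<tau>)"
      proof (intro mult_left_mono)
        have "0 \<le> \<tau> * \<tau>" by simp
        then show "\<rho>\<^sup>2 - (norm (y - z))\<^sup>2 \<le> 2 * \<rho> * \<tau>"
          by (simp add: \<tau>_def power2_eq_square algebra_simps)
      qed (use \<alpha>0 in auto)
      then have Y1: "?Y \<le> 2 * \<alpha> * \<rho> * \<tau>" by (simp add: algebra_simps)
      also have "\<dots> \<le> 2 * \<alpha> * \<rho> * (r / 2)" using \<tau>r \<alpha>0 \<rho> by (intro mult_left_mono) auto
      also have "\<dots> = (4 * \<alpha> * \<rho> * r) / 4" by simp
      also have "\<dots> \<le> 1" using r(4) by simp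
      finally have Y2: "?Y \<le> 1" .
      have Y0: "0 \<le> ?Y" using \<alpha>0 y by (simp add: power_mono dist_norm norm_minus_commute)
      have "barrier z \<rho> y = exp ?Y - 1" by (simp add: barrier_def \<alpha>_def)
      also have "\<dots> \<le> ?Y + ?Y\<^sup>2" using exp_bound[OF Y0 Y2] by linarith
      also have "?Y\<^sup>2 \<le> ?Y" using mult_right_mono[OF Y2 Y0] by (simp add: power2_eq_square)
      finally have "barrier z \<rho> y \<le> 4 * \<alpha> * \<rho> * \<tau>" using Y1 by linarith
      then have "c * barrier z \<rho> y \<le> c * (4 * \<alpha> * \<rho> * \<tau>)" using c by (intro mult_left_mono) auto
      also have "\<dots> = c2 * \<tau>" using \<alpha>0 \<rho> by (simp add: c_def)
      finally show "(a + c) * barrier z \<rho> y \<le> u y" using v1 by (simp add: v_def algebra_simps)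
    qed
  qed
  show ?thesis by (rule that[OF c main])
qed

text \<open>The barrier has gradient \<open>(2 * \<alpha>) *\<^sub>R (z - x0)\<close> at
  \<open>x0\<close>, whence the factor in the derivative. The second conclusion keeps the maximality
  of \<open>A\<close>, so that any barrier bound on the whole tangent ball later becomes a lower
  bound for the gradient.\<close>

lemma boundary_derivative:
  fixes x0 z :: 'a and \<rho> :: real
  defines "\<alpha> \<equiv> 8 * real DIM('a) / \<rho>\<^sup>2"
  assumes x0: "x0 \<in> frontier \<Omega>" and \<rho>: "0 < \<rho>" and ball: "ball z \<rho> \<subseteq> \<Omega>" and x0z: "norm (x0 - z) = \<rho>"
  obtains A where "(u has_derivative (\<lambda>h. ((2 * \<alpha> * A) *\<^sub>R (z - x0)) \<bullet> h)) (at x0 within closure \<Omega>)"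
    "\<And>m. (\<And>x. x \<in> cball z \<rho> \<Longrightarrow> m * barrier z \<rho> x \<le> u x) \<Longrightarrow> m \<le> A"
proof -
  let ?n = "real DIM('a)"
  have n: "?n \<ge> 1" using DIM_positive[where 'a='a] by linarith
  have \<alpha>0: "0 < \<alpha>" using \<rho> n by (simp add: \<alpha>_def)
  define s where "s x = (x - x0) \<bullet> (z - x0)" for x
  have zx0: "norm (z - x0) = \<rho>" using x0z by (simp add: norm_minus_commute)
  have s_le: "s x \<le> \<rho> * norm (x - x0)" for x
    using norm_cauchy_schwarz[of "x - x0" "z - x0"] zx0 by (simp add: s_def mult.commute)
  have half: "0 \<le> (y - x0) \<bullet> (z - x0)" if "y \<in> closure \<Omega>" for y
    by (rule convex_inner_normal[OF open_domain convex_domain x0 ball x0z \<rho> that])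
  have "z \<noteq> x0" using zx0 \<rho> by auto
  then obtain C where C: "0 < C" "\<And>y. y \<in> closure \<Omega> \<Longrightarrow> u y \<le> C * s y"
    using slab_bound[OF half] unfolding s_def by (metis right_minus_eq)
  have in_closure: "y \<in> closure \<Omega>" if "y \<in> ball z \<rho>" for y
    using that ball closure_subset by blast
  have bar_low: "\<alpha> * (2 * s x - (norm (x - x0))\<^sup>2) \<le> barrier z \<rho> x" for x
    using barrier_ge[of \<rho> x z] sq_dist_from_center[OF x0z, of x] by (simp add: \<alpha>_def s_def)
  have bar_nonneg: "0 \<le> barrier z \<rho> x" if "x \<in> ball z \<rho>" for x
    using that by (intro barrier_nonneg) (simp add: dist_norm norm_minus_commute)
  define S where "S = {a. \<exists>R>0. \<forall>x\<in>ball z \<rho> \<inter> ball x0 R. a * barrier z \<rho> x \<le> u x}"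
  have S0: "0 \<in> S"
    unfolding S_def using nonneg in_closure by (auto intro!: exI[of _ 1])
  have S_le: "a \<le> C / \<alpha>" if a: "a \<in> S" for a
  proof (cases "0 < a")
    case False
    then show ?thesis using C \<alpha>0 by (auto intro: order_trans[of a 0])
  next
    case True
    obtain R where R: "0 < R" "\<And>x. x \<in> ball z \<rho> \<inter> ball x0 R \<Longrightarrow> a * barrier z \<rho> x \<le> u x"
      using a unfolding S_def by blast
    \<comment> \<open>Test point on the radius from \<open>x0\<close> towards \<open>z\<close>:
      there \<open>s x = t * \<rho>\<^sup>2\<close> and the barrier is at least
      \<open>\<alpha> * t * \<rho>\<^sup>2\<close>, so the slab bound gives
      \<open>a * \<alpha> \<le> C\<close> after cancelling \<open>t\<close>.\<close>
    define t where "t = min (1 / 2) (R / (2 * \<rho>))"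
    have t: "0 < t" "t < 1" "t * \<rho> < R"
    proof -
      show "0 < t" "t < 1" using R \<rho> by (auto simp: t_def)
      have "t * \<rho> \<le> R / (2 * \<rho>) * \<rho>" using \<rho> unfolding t_def by (intro mult_right_mono min.cobounded2) auto
      then show "t * \<rho> < R" using R \<rho> by simp
    qed
    define x where "x = x0 + t *\<^sub>R (z - x0)"
    have nx: "norm (x - x0) = t * \<rho>" using t zx0 by (simp add: x_def)
    have sx: "s x = t * \<rho>\<^sup>2" using zx0 by (simp add: s_def x_def power2_norm_eq_inner[symmetric])
    have "x - z = (1 - t) *\<^sub>R (x0 - z)" by (simp add: x_def algebra_simps)
    then have "norm (x - z) = (1 - t) * \<rho>" using t x0z by simp
    also have "\<dots> < \<rho>" using t \<rho> by simp
    finally have xb: "x \<in> ball z \<rho> \<inter> ball x0 R" using nx t by (simp add: dist_norm norm_minus_commute)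
    have "\<alpha> * (t * \<rho>\<^sup>2) \<le> \<alpha> * (2 * s x - (norm (x - x0))\<^sup>2)"
    proof (intro mult_left_mono)
      have "t * (t * \<rho>\<^sup>2) \<le> 1 * (t * \<rho>\<^sup>2)" using t by (intro mult_right_mono) auto
      then show "t * \<rho>\<^sup>2 \<le> 2 * s x - (norm (x - x0))\<^sup>2"
        unfolding sx nx by (simp add: power2_eq_square algebra_simps)
    qed (use \<alpha>0 in auto)
    then have "a * (\<alpha> * (t * \<rho>\<^sup>2)) \<le> a * barrier z \<rho> x"
      using bar_low[of x] True by (intro mult_left_mono) auto
    also have "\<dots> \<le> C * (t * \<rho>\<^sup>2)" using R(2)[OF xb] C(2)[OF in_closure[of x]] xb sx by auto
    finally have "a * \<alpha> \<le> C" using t \<rho> by (simp flip: mult.assoc)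
    then show ?thesis using \<alpha>0 by (simp add: field_simps)
  qed
  then have bdd: "bdd_above S" by (rule bdd_aboveI)
  define A where "A = Sup S"
  have A_upper: "a \<le> A" if "a \<in> S" for a unfolding A_def by (rule cSup_upper[OF that bdd])
  have A0: "0 \<le> A" by (rule A_upper[OF S0])
  define g where "g = 2 * \<alpha> * A"
  have g0: "0 \<le> g" using \<alpha>0 A0 by (simp add: g_def)
  have lower: "\<exists>d>0. \<forall>x\<in>closure \<Omega>. norm (x - x0) < d \<longrightarrow> g * s x - \<eta> * norm (x - x0) \<le> u x"
    if \<eta>: "0 < \<eta>" for \<eta>
  proof -
    \<comment> \<open>Using \<open>a\<close> in place of \<open>A\<close> then changes the linear
      function by at most \<open>\<eta> / 2 * norm (x - x0)\<close>.\<close>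
    define \<epsilon> where "\<epsilon> = \<eta> / (4 * \<alpha> * \<rho>)"
    have \<epsilon>: "0 < \<epsilon>" using \<eta> \<alpha>0 \<rho> by (simp add: \<epsilon>_def)
    obtain a where a: "a \<in> S" "A - \<epsilon> < a" "0 \<le> a"
    proof -
      obtain b where b: "b \<in> S" "A - \<epsilon> < b"
        using less_cSup_iff[OF _ bdd, of "A - \<epsilon>"] S0 \<epsilon> unfolding A_def by auto
      \<comment> \<open>Replacing a negative slope by 0 stays in \<open>S\<close> and keeps
        multiplication by the slope monotone.\<close>
      show ?thesis
        by (rule that[of "max b 0"]) (use b S0 \<epsilon> in \<open>auto simp: max_def\<close>)
    qed
    obtain R where R: "0 < R" "\<And>x. x \<in> ball z \<rho> \<inter> ball x0 R \<Longrightarrow> a * barrier z \<rho> x \<le> u x"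
      using a(1) unfolding S_def by blast
    define d where "d = min R (\<eta> / (2 * (1 + \<alpha> * A)))"
    have \<alpha>A: "0 \<le> \<alpha> * A" using \<alpha>0 A0 by simp
    have d: "0 < d" "d \<le> R" "(\<alpha> * A) * d \<le> \<eta> / 2"
    proof -
      show "0 < d" "d \<le> R" using R \<eta> \<alpha>A by (auto simp: d_def)
      have "d \<le> \<eta> / (2 * (1 + \<alpha> * A))" unfolding d_def by (rule min.cobounded2)
      then have "(1 + \<alpha> * A) * d \<le> \<eta> / 2" using \<alpha>A by (simp add: pos_le_divide_eq algebra_simps)
      then show "(\<alpha> * A) * d \<le> \<eta> / 2" using \<open>0 < d\<close> by (simp add: algebra_simps)
    qed
    have "g * s x - \<eta> * norm (x - x0) \<le> u x" if x: "x \<in> closure \<Omega>" "norm (x - x0) < d" for x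
    proof -
      let ?r = "norm (x - x0)"
      have sx0: "0 \<le> s x" using half[OF x(1)] by (simp add: s_def)
      have "(\<alpha> * A) * ?r \<le> (\<alpha> * A) * d" using x \<alpha>A by (intro mult_left_mono) auto
      then have "(\<alpha> * A) * ?r * ?r \<le> \<eta> / 2 * ?r" using d by (intro mult_right_mono) auto
      then have sq: "\<alpha> * A * ?r\<^sup>2 \<le> \<eta> / 2 * ?r" by (simp add: power2_eq_square mult.assoc)
      show ?thesis
      proof (cases "x \<in> ball z \<rho>")
        case True
        then have "a * barrier z \<rho> x \<le> u x" using x d by (intro R) (auto simp: dist_norm norm_minus_commute)
        moreover have "a * (\<alpha> * (2 * s x - ?r\<^sup>2)) \<le> a * barrier z \<rho> x" by (intro mult_left_mono bar_low a)
        moreover have "a * (\<alpha> * ?r\<^sup>2) \<le> A * (\<alpha> * ?r\<^sup>2)" using A_upper[OF a(1)] \<alpha>0 by (intro mult_right_mono) auto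
        moreover have "(A - a) * (2 * \<alpha> * s x) \<le> \<eta> / 2 * ?r"
        proof -
          have "(A - a) * (2 * \<alpha> * s x) \<le> \<epsilon> * (2 * \<alpha> * (\<rho> * ?r))"
            using a \<alpha>0 sx0 \<epsilon> A_upper[OF a(1)] by (intro mult_mono mult_left_mono s_le) auto
          also have "\<dots> = \<eta> / 2 * ?r" using \<alpha>0 \<rho> by (simp add: \<epsilon>_def)
          finally show ?thesis .
        qed
        moreover have "g * s x = (A - a) * (2 * \<alpha> * s x) + (a * (\<alpha> * (2 * s x - ?r\<^sup>2)) + a * (\<alpha> * ?r\<^sup>2))"
          by (simp add: g_def algebra_simps)
        moreover have "A * (\<alpha> * ?r\<^sup>2) \<le> \<eta> / 2 * ?r" using sq by (simp add: mult_ac)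
        ultimately show ?thesis by simp
      next
        \<comment> \<open>Outside the tangent ball \<open>s x\<close> is at most half the squared
          distance to \<open>x0\<close>, so the linear function is itself negligible and
          \<open>u\<close> being nonnegative suffices.\<close>
        case False
        then have "\<rho>\<^sup>2 \<le> (norm (x - z))\<^sup>2" using \<rho> by (intro power_mono) (auto simp: dist_norm norm_minus_commute)
        then have "2 * s x \<le> ?r\<^sup>2" using sq_dist_from_center[OF x0z, of x] by (simp add: s_def)
        then have "(\<alpha> * A) * (2 * s x) \<le> (\<alpha> * A) * ?r\<^sup>2" using \<alpha>A by (intro mult_left_mono) auto
        then have "g * s x \<le> \<eta> / 2 * ?r" using sq by (simp add: g_def algebra_simps)
        also have "\<dots> \<le> \<eta> * ?r" using \<eta> by (intro mult_right_mono) auto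
        finally show ?thesis using nonneg[OF x(1)] by simp
      qed
    qed
    then show ?thesis using d(1) by blast
  qed
  have upper: "\<exists>d>0. \<forall>x\<in>closure \<Omega>. norm (x - x0) < d \<longrightarrow> u x \<le> g * s x + \<eta> * norm (x - x0)"
    if \<eta>: "0 < \<eta>" for \<eta>
  proof (rule ccontr)
    assume no: "\<not> ?thesis"
    have bad: "\<exists>x\<in>closure \<Omega>. norm (x - x0) < d \<and>
        2 * (8 * ?n / \<rho>\<^sup>2) * A * ((x - x0) \<bullet> (z - x0)) + \<eta> * norm (x - x0) < u x" if "0 < d" for d
      using no that unfolding g_def s_def \<alpha>_def by (meson not_less)
    obtain c where c: "0 < c"
      "\<And>a R. 0 \<le> a \<Longrightarrow> a \<le> A \<Longrightarrow> 0 < R \<Longrightarrow>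
        (\<And>x. x \<in> ball z \<rho> \<inter> ball x0 R \<Longrightarrow> a * barrier z \<rho> x \<le> u x) \<Longrightarrow>
        \<exists>R'>0. \<forall>x\<in>ball z \<rho> \<inter> ball x0 R'. (a + c) * barrier z \<rho> x \<le> u x"
      using barrier_slope_improves[OF \<rho> ball x0z half A0 \<eta> bad] by blast
    \<comment> \<open>With the gain \<open>c\<close> already fixed, a slope within \<open>c\<close>
      of the supremum is improved beyond it.\<close>
    obtain b where b: "b \<in> S" "A - c < b"
      using less_cSup_iff[OF _ bdd, of "A - c"] S0 c(1) unfolding A_def by auto
    define a where "a = max b 0"
    have a: "a \<in> S" "A - c < a" "0 \<le> a" using b S0 by (auto simp: a_def max_def)
    obtain R where R: "0 < R" "\<And>x. x \<in> ball z \<rho> \<inter> ball x0 R \<Longrightarrow> a * barrier z \<rho> x \<le> u x"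
      using a(1) unfolding S_def by blast
    have "a + c \<in> S" unfolding S_def using c(2)[OF a(3) A_upper[OF a(1)] R] by blast
    then show False using A_upper[of "a + c"] a(2) by simp
  qed
  have deriv: "(u has_derivative (\<lambda>h. (g *\<^sub>R (z - x0)) \<bullet> h)) (at x0 within closure \<Omega>)"
    unfolding has_derivative_within_alt
  proof (intro conjI allI impI)
    show "bounded_linear (\<lambda>h. (g *\<^sub>R (z - x0)) \<bullet> h)" by (rule bounded_linear_inner_right)
    fix \<eta> :: real assume \<eta>: "0 < \<eta>"
    obtain d1 where d1: "0 < d1" "\<And>x. x \<in> closure \<Omega> \<Longrightarrow> norm (x - x0) < d1 \<Longrightarrow> g * s x - \<eta> * norm (x - x0) \<le> u x"
      using lower[OF \<eta>] by blast
    obtain d2 where d2: "0 < d2" "\<And>x. x \<in> closure \<Omega> \<Longrightarrow> norm (x - x0) < d2 \<Longrightarrow> u x \<le> g * s x + \<eta> * norm (x - x0)"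
      using upper[OF \<eta>] by blast
    show "\<exists>d>0. \<forall>y\<in>closure \<Omega>. norm (y - x0) < d \<longrightarrow>
        norm (u y - u x0 - (g *\<^sub>R (z - x0)) \<bullet> (y - x0)) \<le> \<eta> * norm (y - x0)"
    proof (intro exI[of _ "min d1 d2"] conjI ballI impI)
      fix y assume y: "y \<in> closure \<Omega>" "norm (y - x0) < min d1 d2"
      have e: "(g *\<^sub>R (z - x0)) \<bullet> (y - x0) = g * s y" by (simp add: s_def inner_commute)
      show "norm (u y - u x0 - (g *\<^sub>R (z - x0)) \<bullet> (y - x0)) \<le> \<eta> * norm (y - x0)"
        using d1(2)[OF y(1)] d2(2)[OF y(1)] y(2) zero_on_frontier[OF x0]
        unfolding e by (simp add: abs_le_iff)
    qed (use d1 d2 in simp)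
  qed
  show ?thesis
  proof (rule that)
    show "(u has_derivative (\<lambda>h. ((2 * \<alpha> * A) *\<^sub>R (z - x0)) \<bullet> h)) (at x0 within closure \<Omega>)"
      using deriv by (simp add: g_def)
    fix m assume m: "\<And>x. x \<in> cball z \<rho> \<Longrightarrow> m * barrier z \<rho> x \<le> u x"
    show "m \<le> A"
      by (rule A_upper, unfold S_def) (use m in \<open>auto intro!: exI[of _ 1]\<close>)
  qed
qed

section \<open>The lower bound for the boundary gradient\<close>

text \<open>At scale \<open>R = min \<sigma> (1 / sqrt \<mu>)\<close> one has
  \<open>\<mu> * R\<^sup>2 \<le> 1\<close>, so the Lipschitz constant near \<open>a\<close> is at
  most \<open>5 * (real DIM('a))\<^sup>2 * u a / R\<close>, and \<open>h\<close> is chosen so that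
  \<open>u\<close> loses at most half of its maximum on \<open>cball a h\<close>. From there
  \<open>k\<close> steps reach any point, by the bound on the diameter.\<close>

lemma lower_bound_on_ball:
  fixes a z :: 'a and \<rho> \<sigma> :: real
  defines "h \<equiv> min \<sigma> (1 / sqrt \<mu>) / (10 * (real DIM('a))\<^sup>2)"
  assumes a: "a \<in> \<Omega>" "\<And>y. y \<in> closure \<Omega> \<Longrightarrow> u y \<le> u a"
    and \<sigma>: "0 < \<sigma>" "2 * \<sigma> \<le> \<rho>" and balls: "ball a \<sigma> \<subseteq> \<Omega>" "ball z \<rho> \<subseteq> \<Omega>"
    and k: "diameter \<Omega> \<le> real k * h"
    and x: "x \<in> cball z (\<rho> / 4)"
  shows "u a / 2 * exp (- 8 * real DIM('a) * real k) \<le> u x"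
proof -
  let ?n = "real DIM('a)"
  have n: "?n \<ge> 1" using DIM_positive[where 'a='a] by linarith
  have n2: "?n * ?n \<ge> 1" "?n \<le> ?n * ?n" using n mult_mono[of 1 ?n 1 ?n] mult_left_mono[of 1 ?n ?n] by auto
  define R where "R = min \<sigma> (1 / sqrt \<mu>)"
  have sq: "0 < sqrt \<mu>" using eigenvalue_pos by simp
  have R: "0 < R" "R \<le> \<sigma>" "\<mu> * R\<^sup>2 \<le> 1"
  proof -
    show "0 < R" "R \<le> \<sigma>" using \<sigma> sq by (auto simp: R_def)
    have "R\<^sup>2 \<le> (1 / sqrt \<mu>)\<^sup>2" using \<open>0 < R\<close> by (intro power_mono) (auto simp: R_def)
    also have "\<dots> = 1 / \<mu>" using eigenvalue_pos by (simp add: power_divide)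
    finally show "\<mu> * R\<^sup>2 \<le> 1" using eigenvalue_pos by (simp add: field_simps)
  qed
  have h_eq: "h = R / (10 * ?n\<^sup>2)" by (simp add: h_def R_def)
  have h: "0 < h" using R n by (simp add: h_eq)
  have h5: "10 * h \<le> R"
  proof -
    have "R / ?n\<^sup>2 \<le> R / 1" using R n2 by (intro divide_left_mono) (auto simp: power2_eq_square)
    then show ?thesis by (simp add: h_eq)
  qed
  have M: "0 < u a" by (rule positive[OF a(1)])
  have near: "u a / 2 \<le> u y" if y: "y \<in> cball a h" for y
  proof -
    have ya: "norm (y - a) \<le> h" using y by (simp add: dist_norm norm_minus_commute)
    have "\<bar>u y - u a\<bar> \<le> ?n * (4 * ?n * u a / R + (\<mu> * u a) * R) * norm (y - a)"
    proof (rule interior_lipschitz[OF R(1)])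
      fix w assume "w \<in> ball a R"
      then have w: "w \<in> \<Omega>" using balls R by auto
      show "u differentiable (at w)" by (rule differentiable[OF w])
      show "\<exists>L. \<bar>L\<bar> \<le> \<mu> * u a \<and> has_lap u L w" by (rule lap_bound[OF a(2) w])
      show "\<bar>u w\<bar> \<le> u a" using positive[OF w] a(2)[of w] w closure_subset[of \<Omega>] by auto
    qed (use ya h5 h in auto)
    also have "\<dots> \<le> (5 * ?n\<^sup>2 * u a / R) * h"
    proof (intro mult_mono ya)
      have "\<mu> * u a * R = (\<mu> * R\<^sup>2) * u a / R" using R by (simp add: power2_eq_square)
      also have "\<dots> \<le> 1 * u a / R" using R M by (intro divide_right_mono mult_right_mono) auto
      also have "\<dots> \<le> ?n * u a / R" using R M n by (intro divide_right_mono mult_right_mono) auto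
      finally have "?n * (4 * ?n * u a / R + \<mu> * u a * R) \<le> ?n * (4 * ?n * u a / R + ?n * u a / R)"
        using n by (intro mult_left_mono add_left_mono) auto
      also have "\<dots> = 5 * ?n\<^sup>2 * u a / R" by (simp add: power2_eq_square field_simps)
      finally show "?n * (4 * ?n * u a / R + \<mu> * u a * R) \<le> 5 * ?n\<^sup>2 * u a / R" .
    qed (use R M in auto)
    also have "\<dots> = u a / 2" using R n by (simp add: h_eq)
    finally show ?thesis by linarith
  qed
  have "u a / 2 * exp (- 8 * ?n * real k) \<le> u x"
  proof (rule superharmonic_chain[where q=a and h=h])
    show "continuous_on \<Omega> u" by (rule continuous_on_subset[OF continuous_closure closure_subset])
    show "superharmonic_on \<Omega> u" by (rule superharmonic)
    show "0 \<le> u y" if "y \<in> \<Omega>" for y using positive[OF that] by simp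
    show "cball a (4 * h) \<subseteq> \<Omega>"
    proof (rule subset_trans[OF _ balls(1)])
      show "cball a (4 * h) \<subseteq> ball a \<sigma>" using h5 h R by auto
    qed
    show xh: "cball x (4 * h) \<subseteq> \<Omega>"
    proof (rule subset_trans[OF _ balls(2)], rule subsetI)
      fix w assume w: "w \<in> cball x (4 * h)"
      then show "w \<in> ball z \<rho>" using x h5 h R \<sigma> dist_triangle[of z w x] by simp
    qed
    have "x \<in> \<Omega>" using xh h by auto
    then have "dist x a \<le> diameter \<Omega>" by (intro diameter_bounded_bound bounded_domain a)
    then show "norm (x - a) \<le> real k * h" using k by (simp add: dist_norm)
  qed (use near h M convex_domain in auto)
  then show ?thesis .
qed

text \<open>With n the dimension, \<open>80 * n ^ 3\<close> is the cost \<open>8 * n\<close> per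
  ball times the factor \<open>10 * n\<^sup>2\<close> in the number of balls. The gradient has
  length \<open>16 * n / \<rho> * A\<close>, and the half lost near the maximum point leaves the
  factor \<open>8 * n\<close>.\<close>

lemma boundary_gradient_bound:
  fixes a x0 :: 'a and \<rho> \<sigma> :: real
  assumes a: "a \<in> \<Omega>" "\<And>y. y \<in> closure \<Omega> \<Longrightarrow> u y \<le> u a"
    and \<sigma>: "0 < \<sigma>" "2 * \<sigma> \<le> \<rho>" and ball: "ball a \<sigma> \<subseteq> \<Omega>"
    and sphere: "interior_sphere_condition \<Omega> \<rho>" and x0: "x0 \<in> frontier \<Omega>"
  obtains G where "(u has_derivative (\<lambda>h. G \<bullet> h)) (at x0 within closure \<Omega>)"
    "8 * real DIM('a) * exp (- 16 * real DIM('a)) / \<rho> * u a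
      * exp (- 80 * real DIM('a) ^ 3 * (diameter \<Omega> * (sqrt \<mu> + 1 / \<sigma>))) \<le> norm G"
proof -
  let ?n = "real DIM('a)" and ?d = "diameter \<Omega>"
  have n: "?n \<ge> 1" using DIM_positive[where 'a='a] by linarith
  have \<rho>: "0 < \<rho>" using \<sigma> by simp
  obtain z where z: "ball z \<rho> \<subseteq> \<Omega>" "norm (x0 - z) = \<rho>"
    using sphere x0 unfolding interior_sphere_condition_def by (auto simp: dist_norm norm_minus_commute)
  define h where "h = min \<sigma> (1 / sqrt \<mu>) / (10 * ?n\<^sup>2)"
  have sq: "0 < sqrt \<mu>" using eigenvalue_pos by simp
  have h: "0 < h" using \<sigma> sq n by (simp add: h_def)
  define k where "k = nat \<lceil>?d / h\<rceil>"
  have d0: "0 \<le> ?d" by (rule diameter_ge_0[OF bounded_domain])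
  have "?d / h \<le> real k" unfolding k_def by (rule real_nat_ceiling_ge)
  then have k1: "?d \<le> real k * h" using h by (simp add: field_simps)
  have "1 / min \<sigma> (1 / sqrt \<mu>) \<le> sqrt \<mu> + 1 / \<sigma>" using \<sigma> sq by (auto simp: min_def)
  then have "10 * ?n\<^sup>2 * (1 / min \<sigma> (1 / sqrt \<mu>)) \<le> 10 * ?n\<^sup>2 * (sqrt \<mu> + 1 / \<sigma>)"
    by (intro mult_left_mono) auto
  then have "1 / h \<le> 10 * ?n\<^sup>2 * (sqrt \<mu> + 1 / \<sigma>)" by (simp add: h_def)
  then have "?d * (1 / h) \<le> ?d * (10 * ?n\<^sup>2 * (sqrt \<mu> + 1 / \<sigma>))" using d0 by (intro mult_left_mono)
  \<comment> \<open>Rounding up adds one ball, hence one factor \<open>exp (- 8 * n)\<close>; the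
    barrier comparison costs another, and together they give \<open>exp (- 16 * n)\<close>.\<close>
  moreover have "real k \<le> ?d / h + 1" using d0 h by (simp add: k_def of_nat_ceiling)
  ultimately have k2: "real k \<le> 10 * ?n\<^sup>2 * (?d * (sqrt \<mu> + 1 / \<sigma>)) + 1" by (simp add: mult_ac)
  define m where "m = u a / 2 * exp (- 8 * ?n * real k)"
  have m0: "0 \<le> m" using positive[OF a(1)] by (simp add: m_def)
  have sub: "cball z \<rho> \<subseteq> closure \<Omega>" using closure_mono[OF z(1)] \<rho> by (simp add: closure_ball)
  have low: "m * exp (- 8 * ?n) * barrier z \<rho> x \<le> u x" if "x \<in> cball z \<rho>" for x
  proof (rule superharmonic_barrier_bound[OF \<rho> _ _ _ m0 _ that])
    show "continuous_on (cball z \<rho>) u" by (rule continuous_on_subset[OF continuous_closure sub])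
    show "superharmonic_on (ball z \<rho>) u" using superharmonic z(1) unfolding superharmonic_on_def by blast
    show "0 \<le> u y" if "norm (y - z) = \<rho>" for y
      using that sub by (intro nonneg) (auto simp: subset_iff dist_norm norm_minus_commute)
    show "m \<le> u y" if "y \<in> cball z (\<rho> / 4)" for y
      unfolding m_def
      by (rule lower_bound_on_ball[OF a \<sigma> ball z(1) _ that]) (use k1 in \<open>simp_all add: h_def\<close>)
  qed
  obtain A where A: "(u has_derivative (\<lambda>h. ((2 * (8 * ?n / \<rho>\<^sup>2) * A) *\<^sub>R (z - x0)) \<bullet> h)) (at x0 within closure \<Omega>)"
    "\<And>m. (\<And>x. x \<in> cball z \<rho> \<Longrightarrow> m * barrier z \<rho> x \<le> u x) \<Longrightarrow> m \<le> A"
    using boundary_derivative[OF x0 \<rho> z] by blast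
  have mA: "m * exp (- 8 * ?n) \<le> A" by (rule A(2)[OF low])
  have A0: "0 \<le> A" using mA m0 by (meson exp_ge_zero mult_nonneg_nonneg order_trans)
  have norm_eq: "norm ((2 * (8 * ?n / \<rho>\<^sup>2) * A) *\<^sub>R (z - x0)) = 16 * ?n / \<rho> * A"
    using A0 \<rho> z(2) by (simp add: norm_minus_commute power2_eq_square)
  have expo: "exp (- 16 * ?n) * exp (- 80 * ?n ^ 3 * (?d * (sqrt \<mu> + 1 / \<sigma>))) \<le> exp (- 8 * ?n * real k) * exp (- 8 * ?n)"
  proof -
    have "8 * ?n * real k \<le> 8 * ?n * (10 * ?n\<^sup>2 * (?d * (sqrt \<mu> + 1 / \<sigma>)) + 1)"
      by (intro mult_left_mono k2) auto
    also have "\<dots> = 80 * ?n ^ 3 * (?d * (sqrt \<mu> + 1 / \<sigma>)) + 8 * ?n"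
      by (simp add: power2_eq_square power3_eq_cube algebra_simps)
    finally have "- 16 * ?n + (- 80 * ?n ^ 3 * (?d * (sqrt \<mu> + 1 / \<sigma>))) \<le> - 8 * ?n * real k + (- 8 * ?n)" by simp
    then show ?thesis by (simp only: exp_add[symmetric] exp_le_cancel_iff)
  qed
  have "8 * ?n / \<rho> * u a * (exp (- 16 * ?n) * exp (- 80 * ?n ^ 3 * (?d * (sqrt \<mu> + 1 / \<sigma>))))
      \<le> 8 * ?n / \<rho> * u a * (exp (- 8 * ?n * real k) * exp (- 8 * ?n))"
    using positive[OF a(1)] \<rho> by (intro mult_left_mono expo) auto
  also have "\<dots> = 16 * ?n / \<rho> * (m * exp (- 8 * ?n))" by (simp add: m_def)
  also have "\<dots> \<le> 16 * ?n / \<rho> * A" using \<rho> by (intro mult_left_mono mA) auto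
  finally have "8 * ?n / \<rho> * u a * (exp (- 16 * ?n) * exp (- 80 * ?n ^ 3 * (?d * (sqrt \<mu> + 1 / \<sigma>))))
      \<le> norm ((2 * (8 * ?n / \<rho>\<^sup>2) * A) *\<^sub>R (z - x0))" unfolding norm_eq .
  moreover have "8 * ?n * exp (- 16 * ?n) / \<rho> * u a * e = 8 * ?n / \<rho> * u a * (exp (- 16 * ?n) * e)" for e
    by simp
  ultimately show ?thesis by (intro that[OF A(1)]) (simp only:)
qed

text \<open>The domain lies in the closed ball about \<open>a\<close> whose radius is the diameter,
  so the integral of the square of \<open>u\<close> is at most \<open>(u a)\<^sup>2\<close> times
  the volume of that ball.\<close>

lemma max_ge_of_normalized:
  assumes a: "a \<in> \<Omega>" "\<And>y. y \<in> closure \<Omega> \<Longrightarrow> u y \<le> u a"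
    and norm1: "sqrt (LINT y:\<Omega>|lborel. (u y)\<^sup>2) = 1" and d: "0 < diameter \<Omega>"
  shows "diameter \<Omega> powr (- real DIM('a) / 2) / sqrt (unit_ball_vol (real DIM('a))) \<le> u a"
proof -
  let ?n = "real DIM('a)" and ?d = "diameter \<Omega>"
  define f where "f y = indicator \<Omega> y *\<^sub>R (u y)\<^sup>2" for y
  have int1: "integral\<^sup>L lborel f = 1"
    using norm1 unfolding f_def set_lebesgue_integral_def by simp
  \<comment> \<open>A non-integrable function has integral 0 by convention, so the value 1 already
    yields integrability.\<close>
  then have f: "integrable lborel f" using not_integrable_integral_eq[of lborel f] by fastforce
  have M: "0 < u a" by (rule positive[OF a(1)])
  have sub: "\<Omega> \<subseteq> cball a ?d"
    using diameter_bounded_bound[OF bounded_domain a(1)] by auto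
  have fin: "emeasure lborel (cball a ?d) < \<infinity>"
    by (rule emeasure_bounded_finite) simp
  have "1 \<le> (LINT y|lborel. (u a)\<^sup>2 * indicator (cball a ?d) y)"
    unfolding int1[symmetric]
  proof (rule integral_mono[OF f])
    show "integrable lborel (\<lambda>y. (u a)\<^sup>2 * indicator (cball a ?d) y)"
      using fin by (intro integrable_mult_right integrable_real_indicator) auto
    fix y
    show "f y \<le> (u a)\<^sup>2 * indicator (cball a ?d) y"
    proof (cases "y \<in> \<Omega>")
      case True
      then have "(u y)\<^sup>2 \<le> (u a)\<^sup>2"
        using a(2)[of y] positive[OF True] closure_subset[of \<Omega>] by (intro power_mono) auto
      then show ?thesis using True sub by (auto simp: f_def)
    qed (auto simp: f_def)
  qed
  also have "\<dots> = (u a)\<^sup>2 * (unit_ball_vol ?n * ?d ^ DIM('a))"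
    using d by (simp add: content_cball)
  also have "?d ^ DIM('a) = (?d powr (?n / 2))\<^sup>2"
    using d by (simp add: powr_realpow[symmetric] power2_eq_square flip: powr_add)
  also have "unit_ball_vol ?n = (sqrt (unit_ball_vol ?n))\<^sup>2" by simp
  finally have "1\<^sup>2 \<le> (u a * (sqrt (unit_ball_vol ?n) * ?d powr (?n / 2)))\<^sup>2"
    by (simp add: power_mult_distrib)
  then have "1 \<le> u a * (sqrt (unit_ball_vol ?n) * ?d powr (?n / 2))"
    by (rule power2_le_imp_le) (use M in auto)
  then show ?thesis
    using d by (simp add: powr_minus field_simps)
qed

end

section \<open>Inradius, distance to the frontier and the final constants\<close>

lemma inradius_pos:
  fixes \<Omega> :: "'a::euclidean_space set"
  assumes "bounded_convex_domain \<Omega>"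
  shows "0 < inradius \<Omega>"
proof -
  have \<Omega>: "open \<Omega>" "bounded \<Omega>" "\<Omega> \<noteq> {}" using assms by (auto simp: bounded_convex_domain_def)
  obtain x e where x: "0 < e" "ball x e \<subseteq> \<Omega>" using \<Omega> open_contains_ball by blast
  have "e \<le> inradius \<Omega>"
    unfolding inradius_def
  proof (rule cSup_upper)
    \<comment> \<open>Without an upper bound the value of \<open>Sup\<close> would carry no
      information.\<close>
    show "bdd_above {s. 0 < s \<and> (\<exists>x. ball x s \<subseteq> \<Omega>)}"
    proof (rule bdd_aboveI)
      fix s assume "s \<in> {s. 0 < s \<and> (\<exists>x. ball x s \<subseteq> \<Omega>)}"
      then obtain y where "0 < s" "ball y s \<subseteq> \<Omega>" by blast
      then show "s \<le> diameter \<Omega>" using diameter_subset[of "ball y s" \<Omega>] \<Omega> by simp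
    qed
  qed (use x in auto)
  then show ?thesis using x by simp
qed

text \<open>A ball is connected, so if it met both the set and its complement it would contain a
  frontier point.\<close>

lemma ball_subset_of_infdist_frontier:
  fixes a :: "'a::euclidean_space"
  assumes a: "a \<in> \<Omega>" and s: "s \<le> infdist a (frontier \<Omega>)"
  shows "ball a s \<subseteq> \<Omega>"
proof (rule ccontr)
  assume "\<not> ball a s \<subseteq> \<Omega>"
  then obtain y where y: "y \<in> ball a s" "y \<notin> \<Omega>" by blast
  then have "a \<in> ball a s" using zero_le_dist[of a y] by (simp del: zero_le_dist)
  then have "ball a s \<inter> \<Omega> \<noteq> {}" "ball a s - \<Omega> \<noteq> {}" using y a by blast+
  then have "ball a s \<inter> frontier \<Omega> \<noteq> {}" by (intro connected_Int_frontier connected_ball)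
  then obtain w where "w \<in> frontier \<Omega>" "dist a w < s" by auto
  then show False using infdist_le[of w "frontier \<Omega>" a] s by simp
qed

theorem theorem6p1:
  "\<exists>C1 C2 C3 :: real. 1 < C1 \<and> 0 < C2 \<and> 0 < C3 \<and>
     (\<forall>(\<theta>::real) (\<Omega> :: (real ^ 'n) set) (\<rho>::real) (u :: real ^ 'n \<Rightarrow> real).
        maximum_location_constant TYPE(real ^ 'n) \<theta> \<longrightarrow>
        bounded_convex_domain \<Omega> \<longrightarrow>
        0 < \<rho> \<longrightarrow> interior_sphere_condition \<Omega> \<rho> \<longrightarrow>
        first_dirichlet_eigenfunction \<Omega> u \<longrightarrow> (\<forall>x\<in>\<Omega>. 0 < u x) \<longrightarrow>
        (let d = diameter \<Omega>;
             r = inradius \<Omega>;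
             lam = first_dirichlet_eigenvalue \<Omega>;
             N = real CARD('n);
             \<sigma> = min (\<rho> / 2) (C0 TYPE(real ^ 'n) \<theta> * r);
             E = C1 powr (- d * (sqrt lam / 2 + 2 * sqrt N / \<sigma>))
         in \<exists>G. boundary_gradient \<Omega> u G \<and>
              (\<forall>x\<in>frontier \<Omega>. norm (G x) \<ge> C2 / \<rho> * (SUP y\<in>closure \<Omega>. u y) * E) \<and>
              (sqrt (LINT y:\<Omega>|lborel. (u y)\<^sup>2) = 1 \<longrightarrow>
                 (\<forall>x\<in>frontier \<Omega>. norm (G x) \<ge> C3 / \<rho> * d powr (- N / 2) * E))))"
proof -
  let ?N = "real CARD('n)"
  have N: "?N \<ge> 1" using zero_less_card_finite[where 'a='n] by linarith
  \<comment> \<open>\<open>sqrt lam + 1 / \<sigma>\<close> is at most twice the bracket in the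
    exponent of the statement, which doubles 80 to 160. No constant involves \<theta>, which enters
    only through \<sigma>.\<close>
  define C1 where "C1 = exp (160 * ?N ^ 3)"
  define C2 where "C2 = 8 * ?N * exp (- 16 * ?N)"
  define C3 where "C3 = C2 / sqrt (unit_ball_vol ?N)"
  have C: "1 < C1" "0 < C2" "0 < C3" using N by (auto simp: C1_def C2_def C3_def)
  show ?thesis
  proof (rule exI[of _ C1], rule exI[of _ C2], rule exI[of _ C3], intro conjI C allI impI)
    fix \<theta> \<rho> :: real and \<Omega> :: "(real ^ 'n) set" and u :: "real ^ 'n \<Rightarrow> real"
    assume \<theta>: "maximum_location_constant TYPE(real ^ 'n) \<theta>" and \<Omega>: "bounded_convex_domain \<Omega>"
      and \<rho>: "0 < \<rho>" and sphere: "interior_sphere_condition \<Omega> \<rho>"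
      and eig: "first_dirichlet_eigenfunction \<Omega> u" and pos: "\<forall>x\<in>\<Omega>. 0 < u x"
    define d where "d = diameter \<Omega>"
    define lam where "lam = first_dirichlet_eigenvalue \<Omega>"
    define \<sigma> where "\<sigma> = min (\<rho> / 2) (C0 TYPE(real ^ 'n) \<theta> * inradius \<Omega>)"
    define X where "X = d * (sqrt lam / 2 + 2 * sqrt ?N / \<sigma>)"
    define E where "E = C1 powr (- d * (sqrt lam / 2 + 2 * sqrt ?N / \<sigma>))"
    interpret positive_eigenfunction \<Omega> lam u
      using \<Omega> eig pos by unfold_locales (auto simp: first_dirichlet_eigenfunction_def lam_def)
    obtain a where a: "a \<in> \<Omega>" "\<And>y. y \<in> closure \<Omega> \<Longrightarrow> u y \<le> u a" using maximum_point by blast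
    have C0: "0 < C0 TYPE(real ^ 'n) \<theta>" using \<theta> by (simp add: maximum_location_constant_def)
    have \<sigma>: "0 < \<sigma>" "2 * \<sigma> \<le> \<rho>" using \<rho> C0 inradius_pos[OF \<Omega>] by (auto simp: \<sigma>_def)
    have "C0 TYPE(real ^ 'n) \<theta> * inradius \<Omega> \<le> infdist a (frontier \<Omega>)"
      using \<theta> \<Omega> eig pos a closure_subset[of \<Omega>] unfolding maximum_location_constant_def by blast
    then have ball: "ball a \<sigma> \<subseteq> \<Omega>"
      by (intro ball_subset_of_infdist_frontier a) (simp add: \<sigma>_def)
    have d0: "0 < d"
      using diameter_subset[OF ball bounded_domain] \<sigma> by (simp add: d_def)
    have sup: "(SUP y\<in>closure \<Omega>. u y) = u a"
      by (rule cSup_eq_maximum) (use a closure_subset in auto)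
    have E_le: "E \<le> exp (- 80 * ?N ^ 3 * (d * (sqrt lam + 1 / \<sigma>)))"
    proof -
      have "1 \<le> sqrt ?N" using N by (simp only: real_sqrt_ge_1_iff)
      then have "1 / \<sigma> \<le> 4 * sqrt ?N / \<sigma>"
        using \<sigma> by (intro divide_right_mono) linarith+
      then have "d * (sqrt lam + 1 / \<sigma>) \<le> d * (2 * (sqrt lam / 2 + 2 * sqrt ?N / \<sigma>))"
        using d0 by (intro mult_left_mono) auto
      also have "\<dots> = 2 * X" by (simp add: X_def)
      finally have "80 * ?N ^ 3 * (d * (sqrt lam + 1 / \<sigma>)) \<le> 80 * ?N ^ 3 * (2 * X)"
        by (intro mult_left_mono) auto
      moreover have "E = exp (- (160 * ?N ^ 3 * X))"
        by (simp add: E_def C1_def powr_def X_def)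
      ultimately show ?thesis by simp
    qed
    have "\<forall>x\<in>frontier \<Omega>. \<exists>g. (u has_derivative (\<lambda>h. g \<bullet> h)) (at x within closure \<Omega>) \<and>
        C2 / \<rho> * u a * E \<le> norm g"
    proof
      fix x assume x: "x \<in> frontier \<Omega>"
      obtain g where g: "(u has_derivative (\<lambda>h. g \<bullet> h)) (at x within closure \<Omega>)"
        "8 * real DIM(real ^ 'n) * exp (- 16 * real DIM(real ^ 'n)) / \<rho> * u a
          * exp (- 80 * real DIM(real ^ 'n) ^ 3 * (diameter \<Omega> * (sqrt lam + 1 / \<sigma>))) \<le> norm g"
        using boundary_gradient_bound[OF a \<sigma> ball sphere x] by blast
      have "C2 / \<rho> * u a * E \<le> C2 / \<rho> * u a * exp (- 80 * ?N ^ 3 * (d * (sqrt lam + 1 / \<sigma>)))"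
        using C \<rho> positive[OF a(1)] by (intro mult_left_mono E_le) auto
      also have "\<dots> \<le> norm g" using g(2) by (simp add: C2_def d_def)
      finally show "\<exists>g. (u has_derivative (\<lambda>h. g \<bullet> h)) (at x within closure \<Omega>) \<and> C2 / \<rho> * u a * E \<le> norm g"
        using g(1) by blast
    qed
    then obtain G where G: "\<And>x. x \<in> frontier \<Omega> \<Longrightarrow> (u has_derivative (\<lambda>h. G x \<bullet> h)) (at x within closure \<Omega>)"
      "\<And>x. x \<in> frontier \<Omega> \<Longrightarrow> C2 / \<rho> * u a * E \<le> norm (G x)"
      by metis
    have "boundary_gradient \<Omega> u G" using G(1) by (simp add: boundary_gradient_def)
    moreover have "\<forall>x\<in>frontier \<Omega>. norm (G x) \<ge> C2 / \<rho> * (SUP y\<in>closure \<Omega>. u y) * E"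
      using G(2) by (simp add: sup)
    moreover have "norm (G x) \<ge> C3 / \<rho> * d powr (- ?N / 2) * E"
      if "sqrt (LINT y:\<Omega>|lborel. (u y)\<^sup>2) = 1" "x \<in> frontier \<Omega>" for x
    proof -
      have "d powr (- ?N / 2) / sqrt (unit_ball_vol ?N) \<le> u a"
        using max_ge_of_normalized[OF a that(1)] d0 by (simp add: d_def)
      then have "C2 / \<rho> * (d powr (- ?N / 2) / sqrt (unit_ball_vol ?N)) * E \<le> C2 / \<rho> * u a * E"
        using C \<rho> by (intro mult_right_mono mult_left_mono) (auto simp: E_def)
      then show ?thesis using G(2)[OF that(2)] by (simp add: C3_def mult_ac)
    qed
    ultimately show "let d = diameter \<Omega>; r = inradius \<Omega>; lam = first_dirichlet_eigenvalue \<Omega>;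
             N = real CARD('n); \<sigma> = min (\<rho> / 2) (C0 TYPE(real ^ 'n) \<theta> * r);
             E = C1 powr (- d * (sqrt lam / 2 + 2 * sqrt N / \<sigma>))
         in \<exists>G. boundary_gradient \<Omega> u G \<and>
              (\<forall>x\<in>frontier \<Omega>. norm (G x) \<ge> C2 / \<rho> * (SUP y\<in>closure \<Omega>. u y) * E) \<and>
              (sqrt (LINT y:\<Omega>|lborel. (u y)\<^sup>2) = 1 \<longrightarrow>
                 (\<forall>x\<in>frontier \<Omega>. norm (G x) \<ge> C3 / \<rho> * d powr (- N / 2) * E))"
      unfolding Let_def d_def[symmetric] lam_def[symmetric] \<sigma>_def[symmetric] E_def[symmetric] by blast
  qed
qed

end
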